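(* Let $k$ be an algebraically closed field of characteristic $0$. If an iterated Hopf Ore extension $H$ of $k$ satisfies a polynomial identity, then $H$ is commutative.
   Context: An iterated Hopf Ore extension of $k$ (IHOE) is a Hopf $k$-algebra (with bijective antipode) $H=k[x_1][x_2;\sigma_2,\delta_2]\cdots[x_n;\sigma_n,\delta_n]$, an iterated skew polynomial algebra ($x_ir-\sigma_i(r)x_i=\delta_i(r)$ for $r\in H_{(i-1)}$), such that each $H_{(i)}:=k\langle x_1,\dots,x_i\rangle$ is a Hopf subalgebra of $H$, $\sigma_i$ is an algebra automorphism of $H_{(i-1)}$ and $\delta_i$ is a $\sigma_i$-derivation of $H_{(i-1)}$. *)

theory Defs
  imports Main "HOL-Computational_Algebra.Polynomial"
begin

definition alg_closed_field :: "'k::field itself \<Rightarrow> bool" where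
  "alg_closed_field _ \<longleftrightarrow> (\<forall>p::'k poly. degree p > 0 \<longrightarrow> (\<exists>z. poly p z = 0))"

definition k_algebra :: "('k::field \<Rightarrow> 'h::ring_1 \<Rightarrow> 'h) \<Rightarrow> bool" where
  "k_algebra sc \<longleftrightarrow> vector_space sc \<and>
     (\<forall>c a b. sc c (a * b) = sc c a * b \<and> sc c (a * b) = a * sc c b)"

text \<open>n-fold tensor power of the k-vector space H: an element is represented by a list of
  pure tensors (each a list u of length n, standing for u!0 \<otimes> ... \<otimes> u!(n-1)).
  Two representatives are equal in the tensor power iff their formal difference in the free
  k-vector space on H^n lies in the span of the multilinearity relations (the standard
  construction of the tensor product).\<close>
definition ind :: "'h list \<Rightarrow> 'h list \<Rightarrow> 'k::field" where
  "ind u v = (if v = u then 1 else 0)"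

inductive_set tens_rel :: "('k::field \<Rightarrow> 'h::ring_1 \<Rightarrow> 'h) \<Rightarrow> nat \<Rightarrow> ('h list \<Rightarrow> 'k) set"
  for sc :: "'k::field \<Rightarrow> 'h::ring_1 \<Rightarrow> 'h" and n :: nat where
  zero: "(\<lambda>_. 0) \<in> tens_rel sc n"
| add: "f \<in> tens_rel sc n \<Longrightarrow> g \<in> tens_rel sc n \<Longrightarrow> (\<lambda>v. f v + g v) \<in> tens_rel sc n"
| smult: "f \<in> tens_rel sc n \<Longrightarrow> (\<lambda>v. c * f v) \<in> tens_rel sc n"
| lin_add: "length u = n \<Longrightarrow> i < n \<Longrightarrow>
     (\<lambda>v. ind (u[i := a + b]) v - ind (u[i := a]) v - ind (u[i := b]) v) \<in> tens_rel sc n"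
| lin_scale: "length u = n \<Longrightarrow> i < n \<Longrightarrow>
     (\<lambda>v. ind (u[i := sc c a]) v - c * ind (u[i := a]) v) \<in> tens_rel sc n"

definition tcoeff :: "'h list list \<Rightarrow> 'h list \<Rightarrow> 'k::field" where
  "tcoeff xs v = of_nat (count_list xs v)"

definition teq :: "('k::field \<Rightarrow> 'h::ring_1 \<Rightarrow> 'h) \<Rightarrow> nat \<Rightarrow> 'h list list \<Rightarrow> 'h list list \<Rightarrow> bool" where
  "teq sc n xs ys \<longleftrightarrow> (\<lambda>v. tcoeff xs v - tcoeff ys v :: 'k) \<in> tens_rel sc n"

definition pt :: "('h \<times> 'h) list \<Rightarrow> 'h list list" where
  "pt xs = map (\<lambda>(a, b). [a, b]) xs"

abbreviation teq2 :: "('k::field \<Rightarrow> 'h::ring_1 \<Rightarrow> 'h) \<Rightarrow> ('h \<times> 'h) list \<Rightarrow> ('h \<times> 'h) list \<Rightarrow> bool" where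
  "teq2 sc xs ys \<equiv> teq sc 2 (pt xs) (pt ys)"

text \<open>Hopf algebra (H, sc) with comultiplication D (given by representatives in H \<otimes> H),
  counit e and antipode S.\<close>
definition hopf_algebra ::
  "('k::field \<Rightarrow> 'h::ring_1 \<Rightarrow> 'h) \<Rightarrow> ('h \<Rightarrow> ('h \<times> 'h) list) \<Rightarrow> ('h \<Rightarrow> 'k) \<Rightarrow> ('h \<Rightarrow> 'h) \<Rightarrow> bool" where
  "hopf_algebra sc D e S \<longleftrightarrow>
     k_algebra sc \<and>
     \<comment> \<open>D is a k-linear map H \<rightarrow> H \<otimes> H\<close>
     (\<forall>a b. teq2 sc (D (a + b)) (D a @ D b)) \<and>
     (\<forall>c a. teq2 sc (D (sc c a)) (map (\<lambda>(x, y). (sc c x, y)) (D a))) \<and>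
     \<comment> \<open>D is an algebra map\<close>
     (\<forall>a b. teq2 sc (D (a * b)) [(x * u, y * v). (x, y) \<leftarrow> D a, (u, v) \<leftarrow> D b]) \<and>
     teq2 sc (D 1) [(1, 1)] \<and>
     \<comment> \<open>coassociativity: (D \<otimes> id) D = (id \<otimes> D) D in H \<otimes> H \<otimes> H\<close>
     (\<forall>a. teq sc 3 [[x, y, b]. (a', b) \<leftarrow> D a, (x, y) \<leftarrow> D a']
                    [[a', x, y]. (a', b) \<leftarrow> D a, (x, y) \<leftarrow> D b]) \<and>
     \<comment> \<open>counit: an algebra map H \<rightarrow> k\<close>
     Vector_Spaces.linear sc (*) e \<and> (\<forall>a b. e (a * b) = e a * e b) \<and> e 1 = 1 \<and>
     (\<forall>a. sum_list (map (\<lambda>(x, y). sc (e x) y) (D a)) = a) \<and>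
     (\<forall>a. sum_list (map (\<lambda>(x, y). sc (e y) x) (D a)) = a) \<and>
     \<comment> \<open>antipode\<close>
     Vector_Spaces.linear sc sc S \<and>
     (\<forall>a. sum_list (map (\<lambda>(x, y). S x * y) (D a)) = sc (e a) 1) \<and>
     (\<forall>a. sum_list (map (\<lambda>(x, y). x * S y) (D a)) = sc (e a) 1)"

inductive_set subalg :: "('k::field \<Rightarrow> 'h::ring_1 \<Rightarrow> 'h) \<Rightarrow> 'h set \<Rightarrow> 'h set"
  for sc :: "'k::field \<Rightarrow> 'h::ring_1 \<Rightarrow> 'h" and X :: "'h set" where
  gen: "a \<in> X \<Longrightarrow> a \<in> subalg sc X"
| scalar: "sc c 1 \<in> subalg sc X"
| add: "a \<in> subalg sc X \<Longrightarrow> b \<in> subalg sc X \<Longrightarrow> a + b \<in> subalg sc X"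
| mult: "a \<in> subalg sc X \<Longrightarrow> b \<in> subalg sc X \<Longrightarrow> a * b \<in> subalg sc X"
| smult: "a \<in> subalg sc X \<Longrightarrow> sc c a \<in> subalg sc X"

text \<open>The subalgebra generated by R and y is the skew polynomial algebra R[y; \<sigma>, \<delta>]:
  \<sigma> is a k-algebra automorphism of R, \<delta> a k-linear \<sigma>-derivation of R,
  y r - \<sigma>(r) y = \<delta>(r) for r \<in> R, and the powers of y are left R-linearly independent
  (the spanning property is automatic from the commutation relation).\<close>
definition ore_step ::
  "('k::field \<Rightarrow> 'h::ring_1 \<Rightarrow> 'h) \<Rightarrow> 'h set \<Rightarrow> 'h \<Rightarrow> ('h \<Rightarrow> 'h) \<Rightarrow> ('h \<Rightarrow> 'h) \<Rightarrow> bool" where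
  "ore_step sc R y \<sigma> \<delta> \<longleftrightarrow>
     bij_betw \<sigma> R R \<and>
     (\<forall>a\<in>R. \<forall>b\<in>R. \<sigma> (a + b) = \<sigma> a + \<sigma> b \<and> \<sigma> (a * b) = \<sigma> a * \<sigma> b) \<and>
     (\<forall>c. \<forall>a\<in>R. \<sigma> (sc c a) = sc c (\<sigma> a)) \<and> \<sigma> 1 = 1 \<and>
     (\<forall>a\<in>R. \<delta> a \<in> R) \<and>
     (\<forall>a\<in>R. \<forall>b\<in>R. \<delta> (a + b) = \<delta> a + \<delta> b \<and> \<delta> (a * b) = \<sigma> a * \<delta> b + \<delta> a * b) \<and>
     (\<forall>c. \<forall>a\<in>R. \<delta> (sc c a) = sc c (\<delta> a)) \<and>
     (\<forall>a\<in>R. y * a - \<sigma> a * y = \<delta> a) \<and>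
     (\<forall>(r::nat \<Rightarrow> 'h) d. (\<forall>m\<le>d. r m \<in> R) \<and> (\<Sum>m\<le>d. r m * y ^ m) = 0 \<longrightarrow> (\<forall>m\<le>d. r m = 0))"

text \<open>B is a Hopf subalgebra (B is already a subalgebra): D(B) \<subseteq> B \<otimes> B and S(B) \<subseteq> B.\<close>
definition hopf_subalg ::
  "('k::field \<Rightarrow> 'h::ring_1 \<Rightarrow> 'h) \<Rightarrow> ('h \<Rightarrow> ('h \<times> 'h) list) \<Rightarrow> ('h \<Rightarrow> 'h) \<Rightarrow> 'h set \<Rightarrow> bool" where
  "hopf_subalg sc D S B \<longleftrightarrow>
     (\<forall>a\<in>B. \<exists>ys. set ys \<subseteq> B \<times> B \<and> teq2 sc (D a) ys) \<and> S ` B \<subseteq> B"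

text \<open>Iterated Hopf Ore extension H = k[x_1][x_2;\<sigma>_2,\<delta>_2]...[x_n;\<sigma>_n,\<delta>_n], with
  H_(i) = k<x_1,...,x_i>; the whole type 'h is H.\<close>
definition IHOE ::
  "('k::field \<Rightarrow> 'h::ring_1 \<Rightarrow> 'h) \<Rightarrow> ('h \<Rightarrow> ('h \<times> 'h) list) \<Rightarrow> ('h \<Rightarrow> 'k) \<Rightarrow> ('h \<Rightarrow> 'h)
     \<Rightarrow> nat \<Rightarrow> (nat \<Rightarrow> 'h) \<Rightarrow> bool" where
  "IHOE sc D e S n x \<longleftrightarrow>
     hopf_algebra sc D e S \<and> bij S \<and> 1 \<le> n \<and>
     subalg sc (x ` {1..n}) = UNIV \<and>
     (\<forall>i\<in>{1..n}. \<exists>\<sigma> \<delta>. ore_step sc (subalg sc (x ` {1..<i})) (x i) \<sigma> \<delta>) \<and>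
     (\<forall>i\<in>{1..n}. hopf_subalg sc D S (subalg sc (x ` {1..i})))"

text \<open>H satisfies a polynomial identity: some nonzero element of the free algebra
  k<X_0, X_1, ...> (represented as a list of (coefficient, monomial word)) vanishes
  under every substitution of elements of H.\<close>
definition satisfies_PI :: "('k::field \<Rightarrow> 'h::ring_1 \<Rightarrow> 'h) \<Rightarrow> bool" where
  "satisfies_PI sc \<longleftrightarrow>
     (\<exists>p :: ('k \<times> nat list) list.
        (\<exists>w. sum_list (map (\<lambda>(c, w'). if w' = w then c else 0) p) \<noteq> 0) \<and>
        (\<forall>h :: nat \<Rightarrow> 'h. sum_list (map (\<lambda>(c, w). sc c (prod_list (map h w))) p) = 0))"

end

theory Submission
  imports Defs "HOL-Library.Multiset"
begin

text \<open>
  Let \<open>R = H\<^sub>(\<^sub>i\<^sub>-\<^sub>1\<^sub>)\<close>, commutative by induction, and \<open>y = x\<^sub>i\<close>.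

  Let \<open>n\<close> be the degree in \<open>y\<close> of the second factor of \<open>\<Delta> y\<close>. Coassociativity gives \<open>n\<^sup>2 = n\<close>, so
  \<open>\<Delta> y = A (1 \<otimes> y) + A'\<close> with second factors in \<open>R\<close>; the element \<open>(1 \<otimes> \<epsilon>) A\<close> is a unit, hence \<open>1\<close>,
  because an iterated Ore extension of a field is a domain whose units are scalars. Comparing the
  coefficients of \<open>y\<close> in \<open>\<Delta> (y a) = \<Delta> (\<sigma> a) \<Delta> y + \<Delta> (\<delta> a)\<close> gives \<open>\<sigma> a = \<Sum> a\<^sub>1 \<epsilon> (\<sigma> a\<^sub>2)\<close>. Applied to the
  generators of \<open>R\<close>, of which each has a comultiplication of the same shape, this shows that \<open>\<sigma>\<close>
  moves the first generator that it does not fix by a nonzero scalar, so \<open>\<sigma>\<close> is the identity or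
  has infinite order.

  On the other hand let \<open>R[y; \<sigma>, \<delta>]\<close> satisfy a multilinear identity. The identity extends to the
  operators \<open>z \<mapsto> \<Sum> r z a\<close> with \<open>r \<in> R\<close>. If \<open>\<sigma>\<close> had infinite order, or \<open>\<sigma> = 1\<close> and \<open>\<delta> \<noteq> 0\<close>, there
  would be operators \<open>Q\<^sub>j\<close> of this kind that kill all elements of degree less than \<open>j\<close> and raise
  the degree \<open>j\<close> to \<open>j + 1\<close>; evaluating the identity on \<open>Q\<^sub>0, \<dots>, Q\<^sub>d\<^sub>-\<^sub>1\<close> at \<open>1\<close> leaves a single term.
  So \<open>\<sigma> = 1\<close>, \<open>\<delta> = 0\<close>, and \<open>R[y]\<close> is commutative.
\<close>

section \<open>Evaluating tensors\<close>

locale k_alg =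
  fixes sc :: "'k::field \<Rightarrow> 'h::ring_1 \<Rightarrow> 'h"
  assumes k_algebra: "k_algebra sc"
begin

sublocale vector_space sc
  using k_algebra by (simp add: k_algebra_def)

lemma sc_mult_left: "sc c a * b = sc c (a * b)"
  and sc_mult_right: "a * sc c b = sc c (a * b)"
  using k_algebra unfolding k_algebra_def by metis+

definition multilin :: "nat \<Rightarrow> ('h list \<Rightarrow> 'h) \<Rightarrow> bool" where
  "multilin n G \<longleftrightarrow> (\<forall>u i. length u = n \<and> i < n \<longrightarrow>
     (\<forall>a b. G (u[i := a + b]) = G (u[i := a]) + G (u[i := b])) \<and>
     (\<forall>c a. G (u[i := sc c a]) = sc c (G (u[i := a]))))"

lemma sum_ind: "finite A \<Longrightarrow> u \<in> A \<Longrightarrow> (\<Sum>v\<in>A. sc (ind u v) (G v)) = G u"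
  by (simp add: ind_def if_distrib [of "\<lambda>c. sc c _"] cong: if_cong)

text \<open>Relations are finitely supported functions, but the induction does not carry their
  support. Claiming that the sum vanishes over every sufficiently large finite set avoids this: in
  the case \<open>add\<close> the union of the two sets serves.\<close>

lemma tens_rel_eval:
  assumes "f \<in> tens_rel sc n" "multilin n G"
  shows "\<exists>A. finite A \<and> (\<forall>A'. finite A' \<and> A \<subseteq> A' \<longrightarrow> (\<Sum>v\<in>A'. sc (f v) (G v)) = 0)"
  using assms(1)
proof induction
  case zero
  show ?case by (intro exI [of _ "{}"]) simp
next
  case (add f g)
  then obtain A B where "finite A" "finite B"
    "\<forall>A'. finite A' \<and> A \<subseteq> A' \<longrightarrow> (\<Sum>v\<in>A'. sc (f v) (G v)) = 0"
    "\<forall>A'. finite A' \<and> B \<subseteq> A' \<longrightarrow> (\<Sum>v\<in>A'. sc (g v) (G v)) = 0" by blast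
  then show ?case
    by (intro exI [of _ "A \<union> B"]) (auto simp: scale_left_distrib sum.distrib)
next
  case (smult f c)
  have "(\<Sum>v\<in>A. sc (c * f v) (G v)) = sc c (\<Sum>v\<in>A. sc (f v) (G v))" for A
    by (simp add: scale_sum_right)
  with smult show ?case by (metis scale_zero_right)
next
  case (lin_add u i a b)
  then show ?case using assms(2)
    by (intro exI [of _ "{u[i := a + b], u[i := a], u[i := b]}"])
      (auto simp: scale_left_diff_distrib sum_subtractf sum_ind multilin_def)
next
  case (lin_scale u i c a)
  have "(\<Sum>v\<in>A. sc (c * ind (u[i := a]) v) (G v)) = sc c (\<Sum>v\<in>A. sc (ind (u[i := a]) v) (G v))" for A
    by (simp add: scale_sum_right)
  then show ?case using lin_scale assms(2)
    by (intro exI [of _ "{u[i := sc c a], u[i := a]}"])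
      (auto simp: scale_left_diff_distrib sum_subtractf sum_ind multilin_def)
qed

lemma sum_list_eq_sum_tcoeff:
  "finite A \<Longrightarrow> set xs \<subseteq> A \<Longrightarrow> sum_list (map G xs) = (\<Sum>v\<in>A. sc (tcoeff xs v) (G v))"
proof (induction xs)
  case Nil
  then show ?case by (simp add: tcoeff_def)
next
  case (Cons x xs)
  have "tcoeff (x # xs) v = (ind x v + tcoeff xs v :: 'k)" for v
    by (simp add: tcoeff_def ind_def)
  with Cons show ?case
    by (simp add: scale_left_distrib sum.distrib sum_ind)
qed

text \<open>The universal property of the tensor power. Equations between tensors are used only
  through this evaluation at multilinear maps with values in the algebra.\<close>

lemma teq_eval:
  assumes "teq sc n xs ys" "multilin n G"
  shows "sum_list (map G xs) = sum_list (map G ys)"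
proof -
  obtain A where A: "finite A" and *: "\<And>A'. finite A' \<Longrightarrow> A \<subseteq> A' \<Longrightarrow>
      (\<Sum>v\<in>A'. sc (tcoeff xs v - tcoeff ys v) (G v)) = 0"
    using tens_rel_eval [OF assms [unfolded teq_def]] by blast
  let ?A = "A \<union> set xs \<union> set ys"
  have "sum_list (map G xs) - sum_list (map G ys) =
      (\<Sum>v\<in>?A. sc (tcoeff xs v - tcoeff ys v) (G v))"
    using A sum_list_eq_sum_tcoeff [of ?A xs G] sum_list_eq_sum_tcoeff [of ?A ys G]
    by (simp add: scale_left_diff_distrib sum_subtractf le_supI1)
  also have "\<dots> = 0" using A by (intro *) auto
  finally show ?thesis by simp
qed

section \<open>Linear maps, functionals and slices of a tensor\<close>

definition lin :: "('h \<Rightarrow> 'h) \<Rightarrow> bool" where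
  "lin F \<longleftrightarrow> (\<forall>a b. F (a + b) = F a + F b) \<and> (\<forall>c a. F (sc c a) = sc c (F a))"

definition linf :: "('h \<Rightarrow> 'k) \<Rightarrow> bool" where
  "linf f \<longleftrightarrow> (\<forall>a b. f (a + b) = f a + f b) \<and> (\<forall>c a. f (sc c a) = c * f a)"

definition bilin :: "('h \<Rightarrow> 'h \<Rightarrow> 'h) \<Rightarrow> bool" where
  "bilin G \<longleftrightarrow> (\<forall>x. lin (G x)) \<and> (\<forall>y. lin (\<lambda>x. G x y))"

lemma lin_zero: "lin F \<Longrightarrow> F 0 = 0"
  unfolding lin_def by (metis add_cancel_right_right)

lemma linf_zero: "linf f \<Longrightarrow> f 0 = 0"
  unfolding linf_def by (metis add_cancel_right_right)

lemma lin_sum: "lin F \<Longrightarrow> F (sum g A) = (\<Sum>i\<in>A. F (g i))"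
  by (induction A rule: infinite_finite_induct) (auto simp: lin_zero, auto simp: lin_def)

lemma lin_sum_list: "lin F \<Longrightarrow> F (sum_list (map g xs)) = sum_list (map (\<lambda>i. F (g i)) xs)"
  by (induction xs) (auto simp: lin_zero, auto simp: lin_def)

lemma linf_sum_list: "linf f \<Longrightarrow> f (sum_list (map g xs)) = sum_list (map (\<lambda>i. f (g i)) xs)"
  by (induction xs) (auto simp: linf_zero, auto simp: linf_def)

lemma lin_diff: "lin f \<Longrightarrow> f (a - b) = f a - f b"
  unfolding lin_def by (metis add_diff_cancel diff_add_cancel)

text \<open>Expanding the first tensor factor in a basis reduces a tensor to its slices.\<close>

lemma bilin_expand:
  fixes xs :: "('h \<times> 'h) list"
  obtains bs :: "'h set" and \<beta> :: "'h \<Rightarrow> 'h \<Rightarrow> 'k"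
  where "finite bs" "\<And>b. linf (\<beta> b)"
    "\<And>G. bilin G \<Longrightarrow> sum_list (map (\<lambda>(x, y). G x y) xs) =
       (\<Sum>b\<in>bs. G b (sum_list (map (\<lambda>(x, y). sc (\<beta> b x) y) xs)))"
proof -
  define E where "E = extend_basis {}"
  have ind: "independent E" and span: "span E = UNIV"
    by (auto simp: E_def independent_extend_basis span_extend_basis independent_empty)
  define \<beta> where "\<beta> b x = representation E x b" for b x
  \<comment> \<open>Only finitely many basis vectors occur in the first entries of
    \<open>xs\<close>; this finite set serves all \<open>G\<close> at once.\<close>
  define bs where "bs = (\<Union>x\<in>fst ` set xs. {b. \<beta> b x \<noteq> 0})"
  have fin: "finite {b. \<beta> b x \<noteq> 0}" for x
    using finite_representation [of E x] by (simp add: \<beta>_def)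
  have lf: "linf (\<beta> b)" for b
    unfolding linf_def \<beta>_def using ind span
    by (simp add: representation_add representation_scale)
  have fbs: "finite bs" using fin by (simp add: bs_def)
  have x_eq: "x = (\<Sum>b\<in>bs. sc (\<beta> b x) b)" if "x \<in> fst ` set xs" for x
  proof -
    have "x = (\<Sum>b | \<beta> b x \<noteq> 0. sc (\<beta> b x) b)"
      using sum_nonzero_representation_eq [OF ind, of x] span by (simp add: \<beta>_def)
    also have "\<dots> = (\<Sum>b\<in>bs. sc (\<beta> b x) b)"
      using that fbs by (intro sum.mono_neutral_left) (auto simp: bs_def)
    finally show ?thesis .
  qed
  have "sum_list (map (\<lambda>(x, y). G x y) xs) =
      (\<Sum>b\<in>bs. G b (sum_list (map (\<lambda>(x, y). sc (\<beta> b x) y) xs)))" if G: "bilin G" for G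
  proof -
    have "G x y = (\<Sum>b\<in>bs. G b (sc (\<beta> b x) y))" if "(x, y) \<in> set xs" for x y
    proof -
      have x: "x \<in> fst ` set xs" using that by force
      have "G x y = G (\<Sum>b\<in>bs. sc (\<beta> b x) b) y" using x_eq [OF x] by simp
      also have "\<dots> = (\<Sum>b\<in>bs. G (sc (\<beta> b x) b) y)"
        using G by (simp add: bilin_def lin_sum [of "\<lambda>x. G x y"])
      also have "\<dots> = (\<Sum>b\<in>bs. G b (sc (\<beta> b x) y))"
        using G by (simp add: bilin_def lin_def)
      finally show ?thesis .
    qed
    then have "sum_list (map (\<lambda>(x, y). G x y) xs) =
        sum_list (map (\<lambda>p. \<Sum>b\<in>bs. G b (sc (\<beta> b (fst p)) (snd p))) xs)"
      by (intro arg_cong [of _ _ sum_list] map_cong) auto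
    also have "\<dots> = (\<Sum>b\<in>bs. sum_list (map (\<lambda>p. G b (sc (\<beta> b (fst p)) (snd p))) xs))"
      by (induction xs) (auto simp: sum.distrib)
    also have "\<dots> = (\<Sum>b\<in>bs. G b (sum_list (map (\<lambda>p. sc (\<beta> b (fst p)) (snd p)) xs)))"
      using G by (simp add: bilin_def lin_sum_list)
    finally show ?thesis by (simp add: case_prod_unfold)
  qed
  with fbs lf show ?thesis by (rule that)
qed

lemma projection_exists:
  assumes "subspace V"
  obtains g where "lin g" "range g \<subseteq> V" "\<And>v. v \<in> V \<Longrightarrow> g v = v"
proof -
  interpret vp: vector_space_pair sc sc ..
  have "Vector_Spaces.linear sc sc (\<lambda>x. x)" by (rule linear_id [unfolded id_def])
  from vp.linear_exists_left_inverse_on [OF this assms]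
  obtain g where "g ` UNIV \<subseteq> V" "Vector_Spaces.linear sc sc g" "\<forall>v\<in>V. g v = v" by auto
  then show ?thesis
    by (intro that [of g])
     (auto simp: lin_def vp.linear_add vp.linear_scale)
qed

end

section \<open>Ore extensions\<close>

context k_alg
begin

definition subalgebra :: "'h set \<Rightarrow> bool" where
  "subalgebra A \<longleftrightarrow> (\<forall>c. sc c 1 \<in> A) \<and> (\<forall>a\<in>A. \<forall>b\<in>A. a + b \<in> A \<and> a * b \<in> A) \<and>
     (\<forall>c. \<forall>a\<in>A. sc c a \<in> A)"

lemma subalgebra_subalg: "subalgebra (subalg sc X)"
  unfolding subalgebra_def by (auto intro: subalg.intros)

end

locale ore_ext = k_alg sc for sc :: "'k::field \<Rightarrow> 'h::ring_1 \<Rightarrow> 'h" +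
  fixes R :: "'h set" and y :: 'h and \<sigma> \<delta> :: "'h \<Rightarrow> 'h"
  assumes subalg_R: "subalgebra R"
    and ore: "ore_step sc R y \<sigma> \<delta>"
begin

lemma R_scalar: "sc c 1 \<in> R"
  and R_add: "a \<in> R \<Longrightarrow> b \<in> R \<Longrightarrow> a + b \<in> R"
  and R_mult: "a \<in> R \<Longrightarrow> b \<in> R \<Longrightarrow> a * b \<in> R"
  and R_scale: "a \<in> R \<Longrightarrow> sc c a \<in> R"
  using subalg_R by (auto simp: subalgebra_def)

lemma R_one: "1 \<in> R"
  using R_scalar [of 1] by simp

lemma R_zero: "0 \<in> R"
  using R_scalar [of 0] by simp

lemma R_minus: "a \<in> R \<Longrightarrow> - a \<in> R"
  using R_scale [of a "- 1"] by simp

lemma R_diff: "a \<in> R \<Longrightarrow> b \<in> R \<Longrightarrow> a - b \<in> R"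
  using R_add [of a "- b"] R_minus by simp

lemmas R_closed = R_scalar R_add R_mult R_scale R_one R_zero R_minus R_diff

lemma bij_\<sigma>: "bij_betw \<sigma> R R"
  and \<sigma>_add: "a \<in> R \<Longrightarrow> b \<in> R \<Longrightarrow> \<sigma> (a + b) = \<sigma> a + \<sigma> b"
  and \<sigma>_mult: "a \<in> R \<Longrightarrow> b \<in> R \<Longrightarrow> \<sigma> (a * b) = \<sigma> a * \<sigma> b"
  and \<sigma>_scale: "a \<in> R \<Longrightarrow> \<sigma> (sc c a) = sc c (\<sigma> a)"
  and \<sigma>_one: "\<sigma> 1 = 1"
  and \<delta>_closed: "a \<in> R \<Longrightarrow> \<delta> a \<in> R"
  and comm: "a \<in> R \<Longrightarrow> y * a = \<sigma> a * y + \<delta> a"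
  using ore unfolding ore_step_def by (simp_all add: algebra_simps)

lemma indep_powers:
  "(\<And>m. m < d \<Longrightarrow> r m \<in> R) \<Longrightarrow> (\<Sum>m<d. r m * y ^ m) = 0 \<Longrightarrow> m < d \<Longrightarrow> r m = 0"
proof -
  assume r: "\<And>m. m < d \<Longrightarrow> r m \<in> R" "(\<Sum>m<d. r m * y ^ m) = 0" "m < d"
  obtain d' where d: "d = Suc d'" using r(3) by (cases d) auto
  have "\<forall>(r::nat \<Rightarrow> 'h) d. (\<forall>m\<le>d. r m \<in> R) \<and> (\<Sum>m\<le>d. r m * y ^ m) = 0 \<longrightarrow> (\<forall>m\<le>d. r m = 0)"
    using ore by (simp add: ore_step_def)
  from this [rule_format, of d' r m] show ?thesis
    using r by (auto simp: d lessThan_Suc_atMost less_Suc_eq_le)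
qed

lemma \<sigma>_closed: "a \<in> R \<Longrightarrow> \<sigma> a \<in> R"
  using bij_\<sigma> by (auto simp: bij_betw_def)

lemma \<sigma>_pow_closed: "a \<in> R \<Longrightarrow> (\<sigma> ^^ n) a \<in> R"
  by (induction n) (auto simp: \<sigma>_closed)

lemma \<sigma>_pow_add: "a \<in> R \<Longrightarrow> b \<in> R \<Longrightarrow> (\<sigma> ^^ n) (a + b) = (\<sigma> ^^ n) a + (\<sigma> ^^ n) b"
  by (induction n) (auto simp: \<sigma>_add \<sigma>_pow_closed)

lemma \<sigma>_pow_mult: "a \<in> R \<Longrightarrow> b \<in> R \<Longrightarrow> (\<sigma> ^^ n) (a * b) = (\<sigma> ^^ n) a * (\<sigma> ^^ n) b"
  by (induction n) (auto simp: \<sigma>_mult \<sigma>_pow_closed)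

lemma \<sigma>_pow_scale: "a \<in> R \<Longrightarrow> (\<sigma> ^^ n) (sc c a) = sc c ((\<sigma> ^^ n) a)"
  by (induction n) (auto simp: \<sigma>_scale \<sigma>_pow_closed)

lemma \<sigma>_pow_one: "(\<sigma> ^^ n) 1 = 1"
  by (induction n) (auto simp: \<sigma>_one)

lemma bij_\<sigma>_pow: "bij_betw (\<sigma> ^^ n) R R"
  by (rule bij_betw_funpow [OF bij_\<sigma>])

lemma \<sigma>_pow_nonzero: "a \<in> R \<Longrightarrow> a \<noteq> 0 \<Longrightarrow> (\<sigma> ^^ n) a \<noteq> 0"
  using bij_\<sigma>_pow [of n] \<sigma>_pow_scale [of 0 n 0] R_zero
  by (auto simp: bij_betw_def inj_on_def)

text \<open>\<open>G n\<close> consists of the elements of degree strictly less than \<open>n\<close>, so that \<open>G 0 = {0}\<close> and \<open>G 1 = R\<close>;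
  \<open>B\<close> is \<open>R[y; \<sigma>, \<delta>]\<close>.\<close>

definition G :: "nat \<Rightarrow> 'h set" where
  "G n = {z. \<exists>r. (\<forall>m. r m \<in> R) \<and> z = (\<Sum>m<n. r m * y ^ m)}"

definition B :: "'h set" where "B = (\<Union>n. G n)"

lemma G_0: "G 0 = {0}"
  using R_zero by (auto simp: G_def)

lemma G_Suc: "z \<in> G (Suc n) \<longleftrightarrow> (\<exists>r\<in>R. \<exists>g\<in>G n. z = r * y ^ n + g)"
proof
  assume "z \<in> G (Suc n)"
  then obtain r where r: "\<And>m. r m \<in> R" "z = (\<Sum>m<Suc n. r m * y ^ m)"
    unfolding G_def by blast
  then have "z = r n * y ^ n + (\<Sum>m<n. r m * y ^ m)" by simp
  moreover have "(\<Sum>m<n. r m * y ^ m) \<in> G n" using r unfolding G_def by blast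
  ultimately show "\<exists>r\<in>R. \<exists>g\<in>G n. z = r * y ^ n + g" using r by blast
next
  assume "\<exists>r\<in>R. \<exists>g\<in>G n. z = r * y ^ n + g"
  then obtain r s where "r \<in> R" "\<And>m. s m \<in> R" "z = r * y ^ n + (\<Sum>m<n. s m * y ^ m)"
    unfolding G_def by blast
  then show "z \<in> G (Suc n)"
    unfolding G_def by (auto intro!: exI [of _ "s(n := r)"] simp: add.commute)
qed

lemma G_add: "z \<in> G n \<Longrightarrow> w \<in> G n \<Longrightarrow> z + w \<in> G n"
proof (induction n arbitrary: z w)
  case 0
  then show ?case by (simp add: G_0)
next
  case (Suc n)
  then obtain r g s h where "r \<in> R" "g \<in> G n" "z = r * y ^ n + g" "s \<in> R" "h \<in> G n" "w = s * y ^ n + h"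
    by (metis G_Suc)
  then show ?case unfolding G_Suc
    by (intro bexI [of _ "r + s"] bexI [of _ "g + h"]) (auto simp: algebra_simps Suc.IH R_add)
qed

lemma G_zero: "0 \<in> G n"
  unfolding G_def using R_zero by (auto intro!: exI [of _ "\<lambda>_. 0"])

lemma G_Suc_subset: "z \<in> G n \<Longrightarrow> z \<in> G (Suc n)"
  unfolding G_Suc using R_zero by force

lemma G_mono: "n \<le> m \<Longrightarrow> z \<in> G n \<Longrightarrow> z \<in> G m"
  by (induction m rule: dec_induct) (auto intro: G_Suc_subset)

lemma G_left: "a \<in> R \<Longrightarrow> z \<in> G n \<Longrightarrow> a * z \<in> G n"
proof (induction n arbitrary: z)
  case 0
  then show ?case by (simp add: G_0)
next
  case (Suc n)
  then obtain r g where "r \<in> R" "g \<in> G n" "z = r * y ^ n + g"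
    by (metis G_Suc)
  with Suc show ?case unfolding G_Suc
    by (intro bexI [of _ "a * r"] bexI [of _ "a * g"]) (auto simp: algebra_simps R_mult)
qed

lemma G_scale: "z \<in> G n \<Longrightarrow> sc c z \<in> G n"
  using G_left [OF R_scalar, of z n c] by (simp add: sc_mult_left)

lemma G_minus: "z \<in> G n \<Longrightarrow> - z \<in> G n"
  using G_scale [of z n "- 1"] by simp

lemma monom_in_G: "r \<in> R \<Longrightarrow> r * y ^ n \<in> G (Suc n)"
  unfolding G_Suc using G_zero by force

lemma G_1: "G (Suc 0) = R"
  using G_Suc [of _ 0] by (auto simp: G_0)

lemma y_G: "z \<in> G n \<Longrightarrow> y * z \<in> G (Suc n)"
proof (induction n arbitrary: z)
  case 0
  then show ?case by (simp add: G_0 G_zero)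
next
  case (Suc n)
  then obtain r g where *: "r \<in> R" "g \<in> G n" "z = r * y ^ n + g"
    by (metis G_Suc)
  have "y * z = (y * r) * y ^ n + y * g" using * by (simp add: algebra_simps)
  also have "\<dots> = \<sigma> r * y ^ Suc n + (\<delta> r * y ^ n + y * g)"
    using * by (simp add: comm algebra_simps)
  finally show ?case
    using * Suc.IH G_add [OF monom_in_G [OF \<delta>_closed]] \<sigma>_closed
    unfolding G_Suc [of _ "Suc n"] by blast
qed

text \<open>Moving an element past one \<open>y\<close> applies \<open>\<sigma>\<close> and leaves a
  term with \<open>\<delta>\<close> of one degree less.\<close>

lemma y_pow_mult: "a \<in> R \<Longrightarrow> y ^ n * a - (\<sigma> ^^ n) a * y ^ n \<in> G n"
proof (induction n)
  case 0
  then show ?case by (simp add: G_0)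
next
  case (Suc n)
  let ?g = "y ^ n * a - (\<sigma> ^^ n) a * y ^ n"
  have "y ^ Suc n * a = y * (y ^ n * a)" by (simp add: mult.assoc)
  also have "\<dots> = y * ?g + (y * (\<sigma> ^^ n) a) * y ^ n" by (simp add: algebra_simps)
  also have "y * (\<sigma> ^^ n) a = \<sigma> ((\<sigma> ^^ n) a) * y + \<delta> ((\<sigma> ^^ n) a)"
    using Suc.prems by (simp add: comm \<sigma>_pow_closed)
  finally have "y ^ Suc n * a - (\<sigma> ^^ Suc n) a * y ^ Suc n = y * ?g + \<delta> ((\<sigma> ^^ n) a) * y ^ n"
    by (simp add: algebra_simps)
  with Suc show ?case
    by (auto intro!: G_add y_G monom_in_G \<delta>_closed \<sigma>_pow_closed)
qed

lemma G_right: "a \<in> R \<Longrightarrow> z \<in> G n \<Longrightarrow> z * a \<in> G n"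
proof (induction n arbitrary: z)
  case 0
  then show ?case by (simp add: G_0)
next
  case (Suc n)
  then obtain r g where *: "r \<in> R" "g \<in> G n" "z = r * y ^ n + g"
    by (metis G_Suc)
  have "z * a = (r * (\<sigma> ^^ n) a) * y ^ n + (r * (y ^ n * a - (\<sigma> ^^ n) a * y ^ n) + g * a)"
    using * by (simp add: algebra_simps)
  moreover have "r * (\<sigma> ^^ n) a \<in> R" using * Suc.prems by (intro R_mult \<sigma>_pow_closed)
  moreover have "r * (y ^ n * a - (\<sigma> ^^ n) a * y ^ n) + g * a \<in> G n"
    using * Suc by (auto intro!: G_add G_left [of r] y_pow_mult)
  ultimately show ?case unfolding G_Suc by blast
qed

lemma G_y_pow: "z \<in> G n \<Longrightarrow> z * y ^ m \<in> G (n + m)"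
proof (induction n arbitrary: z)
  case 0
  then show ?case by (simp add: G_0 G_zero)
next
  case (Suc n)
  then obtain r g where *: "r \<in> R" "g \<in> G n" "z = r * y ^ n + g"
    by (metis G_Suc)
  then have "z * y ^ m = r * y ^ (n + m) + g * y ^ m"
    by (simp add: distrib_right mult.assoc power_add)
  with * Suc show ?case by (auto simp: G_Suc)
qed

lemma G_mult_leading:
  assumes "r \<in> R" "g \<in> G n" "s \<in> R" "h \<in> G m"
  obtains k where "k \<in> G (n + m)"
    "(r * y ^ n + g) * (s * y ^ m + h) = r * (\<sigma> ^^ n) s * y ^ (n + m) + k"
proof -
  \<comment> \<open>Bounds in \<open>G\<close> are strict, so degree less than \<open>n\<close>
    times degree at most \<open>m\<close> is less than \<open>n + m\<close>. This absorbs the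
    products that involve \<open>g\<close> or \<open>h\<close>.\<close>
  have G_mult: "z * w \<in> G (n + m)" if "z \<in> G n" "w \<in> G (Suc m)" for z w n m
    using that
  proof (induction m arbitrary: w)
    case 0
    then show ?case by (simp add: G_1 G_right)
  next
    case (Suc m)
    then obtain s h where *: "s \<in> R" "h \<in> G (Suc m)" "w = s * y ^ Suc m + h"
      by (metis G_Suc)
    have "z * w = z * s * y ^ Suc m + z * h" using * by (simp add: algebra_simps)
    moreover have "z * s * y ^ Suc m \<in> G (n + Suc m)"
      using * Suc.prems by (intro G_y_pow G_right)
    moreover have "z * h \<in> G (n + Suc m)"
      using * Suc by (intro G_mono [of "n + m" "n + Suc m"]) auto
    ultimately show ?case by (simp only: G_add)
  qed
  let ?k = "r * (y ^ n * s - (\<sigma> ^^ n) s * y ^ n) * y ^ m + (r * y ^ n * h + g * (s * y ^ m + h))"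
  have h: "h \<in> G (Suc m)" using assms by (auto intro: G_Suc_subset)
  have sh: "s * y ^ m + h \<in> G (Suc m)" using assms by (auto simp: G_Suc)
  have "r * y ^ n * h \<in> G (n + m)"
  proof (cases m)
    case 0
    then show ?thesis using assms by (simp add: G_0 G_zero)
  next
    case (Suc l)
    then show ?thesis using G_mult [of "r * y ^ n" "Suc n" h l] assms monom_in_G by simp
  qed
  then have "?k \<in> G (n + m)"
    using assms sh by (auto intro!: G_add G_y_pow G_left y_pow_mult G_mult)
  moreover have "(r * y ^ n + g) * (s * y ^ m + h) = r * (\<sigma> ^^ n) s * y ^ (n + m) + ?k"
    unfolding power_add by (simp add: algebra_simps)
  ultimately show ?thesis by (rule that)
qed

lemma B_subalgebra: "subalgebra B"
proof -
  have "a + b \<in> B" "a * b \<in> B" if ab: "a \<in> B" "b \<in> B" for a b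
  proof -
    obtain n where n: "a \<in> G (Suc n)" "b \<in> G (Suc n)"
      using ab unfolding B_def
      by (metis G_mono UN_E le_SucI max.cobounded1 max.cobounded2)
    then show "a + b \<in> B" using G_add by (auto simp: B_def)
    obtain r g s h where *: "r \<in> R" "g \<in> G n" "a = r * y ^ n + g"
      "s \<in> R" "h \<in> G n" "b = s * y ^ n + h"
      using n by (auto simp: G_Suc)
    obtain k where "k \<in> G (n + n)" "a * b = r * (\<sigma> ^^ n) s * y ^ (n + n) + k"
      using G_mult_leading [OF *(1,2,4,5)] *(3,6) by metis
    moreover have "r * (\<sigma> ^^ n) s \<in> R" using * by (intro R_mult \<sigma>_pow_closed)
    ultimately have "a * b \<in> G (Suc (n + n))" unfolding G_Suc by blast
    then show "a * b \<in> B" by (auto simp: B_def)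
  qed
  moreover have "sc c 1 \<in> B" for c
    using R_scalar G_1 by (auto simp: B_def)
  moreover have "sc c a \<in> B" if "a \<in> B" for c a
    using that G_scale by (auto simp: B_def)
  ultimately show ?thesis by (auto simp: subalgebra_def)
qed

lemma R_subset_B: "R \<subseteq> B"
  using G_1 by (auto simp: B_def)

lemma y_in_G: "y \<in> G (Suc (Suc 0))"
  using monom_in_G [OF R_one, of "Suc 0"] by simp

lemma G_subset_B: "z \<in> G n \<Longrightarrow> z \<in> B"
  by (auto simp: B_def)

lemma y_in_B: "y \<in> B"
  using y_in_G by (rule G_subset_B)

lemma G_subset_subalgebra:
  assumes "subalgebra C" "R \<subseteq> C" "y \<in> C"
  shows "z \<in> G n \<Longrightarrow> z \<in> C"
proof (induction n arbitrary: z)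
  case 0
  then show ?case using assms(1,2) R_zero by (auto simp: G_0)
next
  case (Suc n)
  have "y ^ n \<in> C"
  proof (induction n)
    case 0
    then show ?case using assms(2) R_one by auto
  next
    case (Suc n)
    then show ?case using assms by (auto simp: subalgebra_def)
  qed
  with Suc assms show ?case by (auto simp: G_Suc subalgebra_def)
qed

text \<open>Identifies the skew polynomials in \<open>y\<close> with the next algebra of the tower,
  which is given by generators.\<close>

lemma B_eq_subalg:
  assumes "R = subalg sc X"
  shows "B = subalg sc (insert y X)"
proof
  have "a \<in> subalg sc (insert y X)" if "a \<in> subalg sc X" for a
    using that by induction (auto intro: subalg.intros)
  then have "R \<subseteq> subalg sc (insert y X)" using assms by blast
  from G_subset_subalgebra [OF subalgebra_subalg this]
  show "B \<subseteq> subalg sc (insert y X)"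
    by (auto simp: B_def intro: subalg.gen)
  show "subalg sc (insert y X) \<subseteq> B"
  proof
    fix a assume "a \<in> subalg sc (insert y X)"
    then show "a \<in> B"
    proof induction
      case (gen a)
      then show ?case using y_in_B R_subset_B assms by (auto intro: subalg.gen)
    qed (use B_subalgebra in \<open>auto simp: subalgebra_def\<close>)
  qed
qed

subsection \<open>Coefficients\<close>

definition is_rep :: "'h \<Rightarrow> (nat \<Rightarrow> 'h) \<Rightarrow> bool" where
  "is_rep z r \<longleftrightarrow> (\<forall>m. r m \<in> R) \<and> (\<exists>N. (\<forall>m\<ge>N. r m = 0) \<and> z = (\<Sum>m<N. r m * y ^ m))"

definition co :: "'h \<Rightarrow> nat \<Rightarrow> 'h" where
  "co z = (SOME r. is_rep z r)"

lemma is_rep_sum: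
  assumes "is_rep z r"
  obtains N where "\<And>m. m \<ge> N \<Longrightarrow> r m = 0" "\<And>M. M \<ge> N \<Longrightarrow> z = (\<Sum>m<M. r m * y ^ m)"
proof -
  obtain N where N: "\<forall>m\<ge>N. r m = 0" "z = (\<Sum>m<N. r m * y ^ m)"
    using assms by (auto simp: is_rep_def)
  have "z = (\<Sum>m<M. r m * y ^ m)" if "M \<ge> N" for M
    unfolding N(2) using that N(1) by (intro sum.mono_neutral_left) auto
  with N(1) that show ?thesis by blast
qed

lemma is_rep_unique: "is_rep z r \<Longrightarrow> is_rep z s \<Longrightarrow> r = s"
proof
  fix m assume rs: "is_rep z r" "is_rep z s"
  from rs(1) obtain N where N: "\<And>m. m \<ge> N \<Longrightarrow> r m = 0" "\<And>M. M \<ge> N \<Longrightarrow> z = (\<Sum>m<M. r m * y ^ m)"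
    by (rule is_rep_sum) blast
  from rs(2) obtain N' where N': "\<And>m. m \<ge> N' \<Longrightarrow> s m = 0" "\<And>M. M \<ge> N' \<Longrightarrow> z = (\<Sum>m<M. s m * y ^ m)"
    by (rule is_rep_sum) blast
  let ?M = "Suc (N + N' + m)"
  have "(\<Sum>m<?M. (r m - s m) * y ^ m) = 0"
    using N(2) [of ?M] N'(2) [of ?M] by (simp add: left_diff_distrib sum_subtractf)
  then have "r m - s m = 0"
    by (rule indep_powers [rotated]) (use rs in \<open>auto simp: is_rep_def R_diff\<close>)
  then show "r m = s m" by simp
qed

lemma co_eqI: "is_rep z r \<Longrightarrow> co z = r"
  unfolding co_def by (metis is_rep_unique someI)

lemma G_is_rep: "z \<in> G n \<Longrightarrow> \<exists>r. is_rep z r \<and> (\<forall>m\<ge>n. r m = 0)"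
proof -
  assume "z \<in> G n"
  then obtain r where r: "\<forall>m. r m \<in> R" "z = (\<Sum>m<n. r m * y ^ m)" by (auto simp: G_def)
  have "is_rep z (\<lambda>m. if m < n then r m else 0)"
    unfolding is_rep_def using r R_zero by (auto intro!: exI [of _ n] sum.cong)
  then show ?thesis by force
qed

lemma is_rep_co: "z \<in> B \<Longrightarrow> is_rep z (co z)"
  using G_is_rep co_eqI unfolding B_def by blast

lemma co_closed: "z \<in> B \<Longrightarrow> co z m \<in> R"
  using is_rep_co by (auto simp: is_rep_def)

lemma co_zero_G: "z \<in> G n \<Longrightarrow> n \<le> m \<Longrightarrow> co z m = 0"
  using G_is_rep co_eqI by blast

lemma co_add: "z \<in> B \<Longrightarrow> w \<in> B \<Longrightarrow> co (z + w) m = co z m + co w m"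
proof -
  assume zw: "z \<in> B" "w \<in> B"
  from is_rep_co [OF zw(1)] obtain N where N: "\<And>m. m \<ge> N \<Longrightarrow> co z m = 0" "\<And>M. M \<ge> N \<Longrightarrow> z = (\<Sum>m<M. co z m * y ^ m)"
    by (rule is_rep_sum) blast
  from is_rep_co [OF zw(2)] obtain N' where N': "\<And>m. m \<ge> N' \<Longrightarrow> co w m = 0" "\<And>M. M \<ge> N' \<Longrightarrow> w = (\<Sum>m<M. co w m * y ^ m)"
    by (rule is_rep_sum) blast
  have "is_rep (z + w) (\<lambda>m. co z m + co w m)"
    unfolding is_rep_def
  proof (intro conjI exI [of _ "N + N'"])
    show "z + w = (\<Sum>m<N + N'. (co z m + co w m) * y ^ m)"
      using N(2) [of "N + N'"] N'(2) [of "N + N'"] by (simp add: distrib_right sum.distrib)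
  qed (use zw N N' in \<open>auto simp: co_closed R_add\<close>)
  then show ?thesis by (simp add: co_eqI)
qed

lemma co_left: "a \<in> R \<Longrightarrow> z \<in> B \<Longrightarrow> co (a * z) m = a * co z m"
proof -
  assume az: "a \<in> R" "z \<in> B"
  from is_rep_co [OF az(2)] obtain N where N: "\<And>m. m \<ge> N \<Longrightarrow> co z m = 0" "\<And>M. M \<ge> N \<Longrightarrow> z = (\<Sum>m<M. co z m * y ^ m)"
    by (rule is_rep_sum) blast
  have "is_rep (a * z) (\<lambda>m. a * co z m)"
    unfolding is_rep_def
  proof (intro conjI exI [of _ N])
    show "a * z = (\<Sum>m<N. (a * co z m) * y ^ m)"
      using arg_cong [OF N(2) [of N], of "\<lambda>z. a * z"] by (simp add: sum_distrib_left mult.assoc)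
  qed (use az N in \<open>auto simp: co_closed R_mult\<close>)
  then show ?thesis by (simp add: co_eqI)
qed

lemma co_scale: "z \<in> B \<Longrightarrow> co (sc c z) m = sc c (co z m)"
  using co_left [OF R_scalar, of z c m] by (simp add: sc_mult_left)

lemma co_monom: "r \<in> R \<Longrightarrow> co (r * y ^ n) m = (if m = n then r else 0)"
proof -
  assume r: "r \<in> R"
  have "is_rep (r * y ^ n) (\<lambda>m. if m = n then r else 0)"
    unfolding is_rep_def
    by (auto intro!: exI [of _ "Suc n"] simp: r R_zero if_distrib [of "\<lambda>c. c * _"] cong: if_cong)
  then show ?thesis by (simp add: co_eqI)
qed

lemma co_leading: "r \<in> R \<Longrightarrow> g \<in> G n \<Longrightarrow> co (r * y ^ n + g) n = r"
  using co_add [of "r * y ^ n" g n] by (auto simp: co_monom co_zero_G intro: G_subset_B monom_in_G)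

lemma G_leading: "z \<in> G (Suc n) \<Longrightarrow> \<exists>g\<in>G n. z = co z n * y ^ n + g"
  by (auto simp: G_Suc co_leading)

lemma co_mult_leading:
  assumes "z \<in> G (Suc n)" "w \<in> G (Suc m)"
  shows "z * w \<in> G (Suc (n + m))" "co (z * w) (n + m) = co z n * (\<sigma> ^^ n) (co w m)"
proof -
  obtain g h where gh: "g \<in> G n" "z = co z n * y ^ n + g" "h \<in> G m" "w = co w m * y ^ m + h"
    using assms G_leading by blast
  have c: "co z n \<in> R" "co w m \<in> R" using assms by (auto intro: co_closed G_subset_B)
  obtain k where k: "k \<in> G (n + m)" "z * w = co z n * (\<sigma> ^^ n) (co w m) * y ^ (n + m) + k"
    using G_mult_leading [OF c(1) gh(1) c(2) gh(3)] gh(2,4) by metis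
  have c': "co z n * (\<sigma> ^^ n) (co w m) \<in> R"
    using c by (auto intro: R_mult \<sigma>_pow_closed)
  show "z * w \<in> G (Suc (n + m))" using k c' by (auto simp: G_Suc)
  show "co (z * w) (n + m) = co z n * (\<sigma> ^^ n) (co w m)" using k c' co_leading by simp
qed

lemma exact_degree:
  assumes "z \<in> B" "z \<noteq> 0"
  obtains n where "z \<in> G (Suc n)" "co z n \<noteq> 0"
proof -
  define k where "k = (LEAST n. z \<in> G n)"
  have k: "z \<in> G k"
    unfolding k_def using assms(1) by (auto simp: B_def intro: LeastI [of "\<lambda>n. z \<in> G n"])
  obtain n where n: "k = Suc n" using k assms(2) by (cases k) (auto simp: G_0)
  have "z \<notin> G n" using not_less_Least [of n "\<lambda>n. z \<in> G n"] n by (simp add: k_def)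
  moreover have "\<exists>g\<in>G n. z = co z n * y ^ n + g" using k n G_leading by blast
  ultimately have "co z n \<noteq> 0" by force
  with k n that show ?thesis by blast
qed

text \<open>Leading coefficients multiply to \<open>co z n * (\<sigma> ^^ n) (co w m)\<close>, which
  is nonzero because \<open>R\<close> is a domain and \<open>\<sigma>\<close> is injective on
  it.\<close>

lemma domain_B:
  assumes dom: "\<And>a b. a \<in> R \<Longrightarrow> b \<in> R \<Longrightarrow> a * b = 0 \<Longrightarrow> a = 0 \<or> b = 0"
    and zw: "z \<in> B" "w \<in> B" "z * w = 0"
  shows "z = 0 \<or> w = 0"
proof (rule ccontr)
  assume "\<not> ?thesis"
  then obtain n m where nm: "z \<in> G (Suc n)" "co z n \<noteq> 0" "w \<in> G (Suc m)" "co w m \<noteq> 0"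
    using zw exact_degree by metis
  have "co z n * (\<sigma> ^^ n) (co w m) = 0"
    using co_mult_leading(2) [OF nm(1,3)] zw(3) co_zero_G [OF G_zero, of 0 "n + m"] by simp
  then show False
    using dom nm zw co_closed \<sigma>_pow_closed \<sigma>_pow_nonzero by metis
qed

text \<open>No leading coefficient cancels, so degrees add and both factors of \<open>1\<close> have
  degree zero, that is, lie in \<open>R\<close>.\<close>

lemma units_B:
  assumes dom: "\<And>a b. a \<in> R \<Longrightarrow> b \<in> R \<Longrightarrow> a * b = 0 \<Longrightarrow> a = 0 \<or> b = 0"
    and units: "\<And>a b. a \<in> R \<Longrightarrow> b \<in> R \<Longrightarrow> a * b = 1 \<Longrightarrow> \<exists>c. a = sc c 1"
    and zw: "z \<in> B" "w \<in> B" "z * w = 1"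
  shows "\<exists>c. z = sc c 1"
proof -
  have "z \<noteq> 0" "w \<noteq> 0" using zw(3) by auto
  then obtain n m where nm: "z \<in> G (Suc n)" "co z n \<noteq> 0" "w \<in> G (Suc m)" "co w m \<noteq> 0"
    using zw exact_degree by metis
  have "co z n * (\<sigma> ^^ n) (co w m) \<noteq> 0"
    using dom nm zw co_closed \<sigma>_pow_closed \<sigma>_pow_nonzero by metis
  then have "co 1 (n + m) \<noteq> 0"
    using co_mult_leading(2) [OF nm(1,3)] zw(3) by simp
  then have "n = 0" "m = 0"
    using co_monom [OF R_one, of 0 "n + m"] by (auto split: if_splits)
  then show ?thesis using nm(1,3) units zw(3) by (auto simp: G_1)
qed

end

section \<open>Polynomial identities\<close>

context k_alg
begin

lemma sum_list_collect:
  assumes "finite A" "snd ` set p \<subseteq> A"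
  shows "sum_list (map (\<lambda>(c, w). sc c (g w)) p) =
    (\<Sum>w\<in>A. sc (sum_list (map (\<lambda>(c, w'). if w' = w then c else 0) p)) (g w))"
  using assms(2)
proof (induction p)
  case Nil
  then show ?case by simp
next
  case (Cons a p)
  obtain c v where a: "a = (c, v)" by force
  have "(\<Sum>w\<in>A. sc (if v = w then c else 0) (g w)) = sc c (g v)"
    using Cons.prems assms(1) a by (simp add: if_distrib [of "\<lambda>c. sc c _"] cong: if_cong)
  with Cons show ?case by (simp add: a scale_left_distrib sum.distrib)
qed

text \<open>Distributivity, with \<open>w\<close> read as labelling positions by variables: the
  lists \<open>q\<close> are the ways to spell \<open>v\<close> with positions from
  \<open>S\<close>.\<close>

lemma prod_list_sum_expand:
  fixes w :: "nat \<Rightarrow> nat" and Z :: "nat \<Rightarrow> 'h"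
  assumes "finite S"
  shows "prod_list (map (\<lambda>i. \<Sum>p | p \<in> S \<and> w p = i. Z p) v) =
    (\<Sum>q | set q \<subseteq> S \<and> map w q = v. prod_list (map Z q))"
proof (induction v)
  case Nil
  have "{q. set q \<subseteq> S \<and> map w q = []} = {[]}" by auto
  then show ?case by simp
next
  case (Cons i v)
  let ?P = "{p. p \<in> S \<and> w p = i}" and ?Q = "{q. set q \<subseteq> S \<and> map w q = v}"
  have eq: "{q. set q \<subseteq> S \<and> map w q = i # v} = (\<lambda>(p, q). p # q) ` (?P \<times> ?Q)"
    by (auto simp: map_eq_Cons_conv image_iff)
  have "(\<Sum>q | set q \<subseteq> S \<and> map w q = i # v. prod_list (map Z q)) =
      (\<Sum>(p, q)\<in>?P \<times> ?Q. Z p * prod_list (map Z q))"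
    unfolding eq by (subst sum.reindex) (auto simp: inj_on_def case_prod_unfold)
  also have "\<dots> = (\<Sum>p\<in>?P. Z p) * (\<Sum>q\<in>?Q. prod_list (map Z q))"
    by (simp add: sum_product sum.cartesian_product)
  finally show ?case using Cons by simp
qed

text \<open>Inclusion-exclusion without signs: by induction every proper subset contributes zero, so
  the sum over \<open>Pow S\<close> is \<open>a S\<close>.\<close>

lemma sum_subsets_zero:
  fixes a :: "'i set \<Rightarrow> 'h"
  assumes "finite S" "\<And>T. T \<subseteq> S \<Longrightarrow> (\<Sum>U\<in>Pow T. a U) = 0"
  shows "a S = 0"
  using assms
proof (induction S rule: finite_psubset_induct)
  case (psubset S)
  have "a U = 0" if "U \<subset> S" for U
    using psubset that by (meson psubset_subset_trans psubset_imp_subset order_trans)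
  moreover have "(\<Sum>U\<in>Pow S. a U) = a S + (\<Sum>U\<in>Pow S - {S}. a U)"
    using psubset.hyps by (intro sum.remove) auto
  moreover have "(\<Sum>U\<in>Pow S. a U) = 0" using psubset.prems by auto
  ultimately show ?case by (simp add: sum.neutral psubset_eq)
qed

text \<open>Take a word \<open>w\<close> of maximal length \<open>d\<close> in the identity and substitute for the variable \<open>i\<close> the sum of the
  \<open>Z p\<close> over the positions \<open>p \<in> S\<close> with \<open>w ! p = i\<close>. Inclusion-exclusion over \<open>S\<close> leaves the terms that use
  all \<open>d\<close> positions, and these are multilinear since no word is longer than \<open>d\<close>.\<close>

lemma multilinear_identity:
  assumes "satisfies_PI sc"
  obtains d and c :: "nat list \<Rightarrow> 'k" where "c [0..<d] \<noteq> 0"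
    "\<And>Z. (\<Sum>q | distinct q \<and> set q = {..<d}. sc (c q) (prod_list (map Z q))) = 0"
proof -
  obtain p :: "('k \<times> nat list) list" and w0
    where w0: "sum_list (map (\<lambda>(c, w'). if w' = w0 then c else 0) p) \<noteq> 0"
      and p: "\<And>h :: nat \<Rightarrow> 'h. sum_list (map (\<lambda>(c, w). sc c (prod_list (map h w))) p) = 0"
    using assms unfolding satisfies_PI_def by blast
  define C where "C w = sum_list (map (\<lambda>(c, w'). if w' = w then c else 0) p)" for w
  have C_zero: "C v = 0" if "v \<notin> snd ` set p" for v
    unfolding C_def using that by (induction p) auto
  have bound: "\<forall>v. C v \<noteq> 0 \<longrightarrow> length v < Suc (Max (length ` snd ` set p))"
  proof (intro allI impI)
    fix v assume "C v \<noteq> 0"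
    then have "v \<in> snd ` set p" using C_zero by blast
    then show "length v < Suc (Max (length ` snd ` set p))"
      unfolding less_Suc_eq_le by (intro Max_ge) auto
  qed
  have "C w0 \<noteq> 0" using w0 by (simp add: C_def)
  then obtain w where w: "C w \<noteq> 0" and max: "\<And>v. C v \<noteq> 0 \<Longrightarrow> length v \<le> length w"
    using ex_has_greatest_nat [of "\<lambda>v. C v \<noteq> 0" w0, OF _ bound] by blast
  define d where "d = length w"
  \<comment> \<open>A list of positions gets the coefficient of the word that it spells in
    \<open>w\<close>; the increasing list spells \<open>w\<close> itself.\<close>
  define c where "c q = C (map ((!) w) q)" for q
  define Q where "Q = {q. set q \<subseteq> {..<d} \<and> length q \<le> d}"
  have finQ: "finite Q" unfolding Q_def by (rule finite_lists_length_le) simp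
  have "c [0..<d] \<noteq> 0" using w by (simp add: c_def d_def map_nth)
  moreover have "(\<Sum>q | distinct q \<and> set q = {..<d}. sc (c q) (prod_list (map Z q))) = 0" for Z
  proof -
    let ?A = "snd ` set p \<union> map ((!) w) ` Q"
    let ?t = "\<lambda>q. sc (c q) (prod_list (map Z q))"
    have sub: "(\<Sum>q | q \<in> Q \<and> set q \<subseteq> S. ?t q) = 0" if S: "S \<subseteq> {..<d}" for S
    proof -
      have finS: "finite S" using S finite_subset by blast
      have "0 = sum_list (map (\<lambda>(c, v). sc c (prod_list
          (map (\<lambda>i. \<Sum>p | p \<in> S \<and> w ! p = i. Z p) v))) p)"
        using p by simp
      also have "\<dots> = (\<Sum>v\<in>?A. sc (C v) (\<Sum>q | set q \<subseteq> S \<and> map ((!) w) q = v. prod_list (map Z q)))"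
        unfolding C_def prod_list_sum_expand [OF finS]
        by (rule sum_list_collect) (use finQ in auto)
      also have "\<dots> = (\<Sum>v\<in>?A. \<Sum>q | q \<in> {q \<in> Q. set q \<subseteq> S} \<and> map ((!) w) q = v. ?t q)"
      proof (rule sum.cong [OF refl])
        fix v
        show "sc (C v) (\<Sum>q | set q \<subseteq> S \<and> map ((!) w) q = v. prod_list (map Z q)) =
            (\<Sum>q | q \<in> {q \<in> Q. set q \<subseteq> S} \<and> map ((!) w) q = v. ?t q)"
        proof (cases "C v = 0")
          case True
          then show ?thesis by (auto simp: c_def intro!: sum.neutral [symmetric])
        next
          case False
          \<comment> \<open>Words with nonzero coefficient have length at most \<open>d\<close>, so
            every list that spells such a word is already in \<open>Q\<close>.\<close>
          then have "{q. set q \<subseteq> S \<and> map ((!) w) q = v} =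
              {q. q \<in> {q \<in> Q. set q \<subseteq> S} \<and> map ((!) w) q = v}"
            using max [of v] S by (auto simp: Q_def d_def)
          then show ?thesis by (simp add: scale_sum_right c_def)
        qed
      qed
      also have "\<dots> = (\<Sum>q | q \<in> Q \<and> set q \<subseteq> S. ?t q)"
        using finQ by (intro sum.group) auto
      finally show ?thesis by simp
    qed
    have "(\<Sum>q | q \<in> Q \<and> set q = {..<d}. ?t q) = 0"
    proof (rule sum_subsets_zero [of "{..<d}" "\<lambda>T. \<Sum>q | q \<in> Q \<and> set q = T. ?t q"])
      fix T :: "nat set" assume T: "T \<subseteq> {..<d}"
      then have finT: "finite T" using finite_subset by blast
      have "(\<Sum>U\<in>Pow T. \<Sum>q | q \<in> {q \<in> Q. set q \<subseteq> T} \<and> set q = U. ?t q) =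
          (\<Sum>q | q \<in> Q \<and> set q \<subseteq> T. ?t q)"
        using finQ finT by (intro sum.group) auto
      moreover have "{q. q \<in> {q \<in> Q. set q \<subseteq> T} \<and> set q = U} = {q. q \<in> Q \<and> set q = U}"
        if "U \<in> Pow T" for U using that by auto
      ultimately show "(\<Sum>U\<in>Pow T. \<Sum>q | q \<in> Q \<and> set q = U. ?t q) = 0"
        using sub [OF T] by simp
    qed simp
    \<comment> \<open>A list of length at most \<open>d\<close> that contains all \<open>d\<close>
      positions is a permutation of them.\<close>
    moreover have "{q. q \<in> Q \<and> set q = {..<d}} = {q. distinct q \<and> set q = {..<d}}"
    proof -
      have "distinct q" if "length q \<le> d" "set q = {..<d}" for q
        using that card_length [of q] by (intro card_distinct) simp
      moreover have "length q \<le> d" if "distinct q" "set q = {..<d}" for q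
        using that distinct_card [of q] by simp
      ultimately show ?thesis by (auto simp: Q_def)
    qed
    ultimately show ?thesis by simp
  qed
  ultimately show ?thesis by (rule that)
qed

text \<open>Only the left multiplier is confined to \<open>R\<close>. Right multiplication by any
  element, \<open>y\<close> included, therefore belongs here once \<open>1 \<in> R\<close>.\<close>

inductive_set ops :: "'h set \<Rightarrow> ('h \<Rightarrow> 'h) set" for R where
  simple: "r \<in> R \<Longrightarrow> (\<lambda>z. r * z * a) \<in> ops R"
| add: "P \<in> ops R \<Longrightarrow> Q \<in> ops R \<Longrightarrow> (\<lambda>z. P z + Q z) \<in> ops R"

lemma ops_lin: "P \<in> ops R \<Longrightarrow> lin P"
  by (induction rule: ops.induct)
    (auto simp: lin_def algebra_simps sc_mult_left sc_mult_right scale_right_distrib)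

lemma ops_comp:
  assumes "subalgebra R" "P \<in> ops R" "Q \<in> ops R"
  shows "(\<lambda>z. P (Q z)) \<in> ops R"
  using assms(2)
proof induction
  case (simple r a)
  show ?case using assms(3)
  proof induction
    case (simple s b)
    have "(\<lambda>z. (r * s) * z * (b * a)) \<in> ops R"
      using simple \<open>r \<in> R\<close> assms(1) by (intro ops.simple) (auto simp: subalgebra_def)
    then show ?case by (simp add: mult.assoc)
  next
    case (add P Q)
    from ops.add [OF add.IH] show ?case by (simp add: algebra_simps)
  qed
next
  case (add P P')
  from ops.add [OF add.IH] show ?case .
qed

lemma fold_lin: "(\<And>i. i \<in> set q \<Longrightarrow> lin (F i)) \<Longrightarrow> lin (fold F q)"
  by (induction q) (auto simp: lin_def)

text \<open>As \<open>q\<close> is distinct, the operator at \<open>k\<close> occurs exactly once,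
  and linearity of the operators applied after it carries the sum through.\<close>

lemma fold_add_at:
  assumes "distinct q" "k \<in> set q" "\<And>i. i \<in> set q \<Longrightarrow> lin (F i)"
  shows "fold (F(k := \<lambda>z. P z + Q z)) q z = fold (F(k := P)) q z + fold (F(k := Q)) q z"
  using assms
proof (induction q arbitrary: z)
  case Nil
  then show ?case by simp
next
  case (Cons i q)
  show ?case
  proof (cases "i = k")
    case True
    have eq: "fold (F(k := A)) q u = fold F q u" for A u
      using Cons.prems True by (intro fold_cong) auto
    have "lin (fold F q)" using Cons.prems by (intro fold_lin) auto
    then show ?thesis unfolding fold_Cons by (simp add: eq True lin_def)
  next
    case False
    then show ?thesis using Cons by simp
  qed
qed

text \<open>A multilinear identity survives the extension of scalars to a commutative subring \<open>R\<close>: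
  it holds for the operators \<open>z \<mapsto> \<Sum> r z a\<close>.\<close>

lemma identity_ops:
  fixes d :: nat and F :: "nat \<Rightarrow> 'h \<Rightarrow> 'h"
  assumes comm: "\<And>a b. a \<in> R \<Longrightarrow> b \<in> R \<Longrightarrow> a * b = b * a"
    and ident: "\<And>Z. (\<Sum>q | distinct q \<and> set q = {..<d}. sc (c q) (prod_list (map Z q))) = 0"
    and ops: "\<And>i. F i \<in> ops R"
  shows "(\<Sum>q | distinct q \<and> set q = {..<d}. sc (c q) (fold F q z)) = 0"
proof -
  let ?\<Phi> = "\<lambda>F :: nat \<Rightarrow> 'h \<Rightarrow> 'h. \<Sum>q | distinct q \<and> set q = {..<d}. sc (c q) (fold F q z)"
  have simple: "?\<Phi> (\<lambda>i z. r i * z * a i) = 0" if r: "\<And>i :: nat. r i \<in> R" for r a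
  proof -
    \<comment> \<open>\<open>fold\<close> applies the head of \<open>q\<close> first, so the right
      multipliers appear in the order of \<open>q\<close> and the left ones in reverse;
      \<open>\<rho> q\<close> is this left product.\<close>
    define \<rho> where "\<rho> q = fold (\<lambda>i x. r i * x) q 1" for q :: "nat list"
    have fold_left: "fold (\<lambda>i x. r i * x) q u * x = fold (\<lambda>i x. r i * x) q (u * x)"
      for q :: "nat list" and u x by (induction q arbitrary: u) (auto simp: mult.assoc)
    have "fold (\<lambda>i z. r i * z * a i) q u = \<rho> q * u * prod_list (map a q)" for q u
    proof (induction q arbitrary: u)
      case Nil
      then show ?case by (simp add: \<rho>_def)
    next
      case (Cons i q)
      have "\<rho> (i # q) = \<rho> q * r i" using fold_left [of q 1 "r i"] by (simp add: \<rho>_def)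
      with Cons show ?case by (simp add: mult.assoc)
    qed
    \<comment> \<open>Commutativity of \<open>R\<close> makes the left product the same for all
      permutations, so it leaves the sum and \<open>ident\<close> applies to the
      \<open>a i\<close>.\<close>
    moreover have "\<rho> q = \<rho> [0..<d]" if "distinct q" "set q = {..<d}" for q
    proof -
      have "mset q = mset [0..<d]"
        using that by (subst set_eq_iff_mset_eq_distinct [symmetric]) (auto simp: atLeast0LessThan)
      moreover have "(\<lambda>x. r i * x) \<circ> (\<lambda>x. r j * x) = (\<lambda>x. r j * x) \<circ> (\<lambda>x. r i * x)" for i j
        using comm [OF r r, of i j] by (auto simp: fun_eq_iff mult.assoc [symmetric])
      ultimately have "fold (\<lambda>i x. r i * x) q = fold (\<lambda>i x. r i * x) [0..<d]"
        by (intro fold_multiset_equiv)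
      then show ?thesis by (simp add: \<rho>_def)
    qed
    ultimately have "?\<Phi> (\<lambda>i z. r i * z * a i) = (\<Sum>q | distinct q \<and> set q = {..<d}.
        \<rho> [0..<d] * z * sc (c q) (prod_list (map a q)))"
      by (intro sum.cong) (auto simp: sc_mult_right)
    also have "\<dots> = 0" by (simp add: ident flip: sum_distrib_left)
    finally show ?thesis .
  qed
  \<comment> \<open>The number \<open>k\<close> bounds the indices whose operator may be a proper
    sum. Additivity in the operator at \<open>k\<close> lowers this bound by one.\<close>
  have "?\<Phi> F = 0" if "\<forall>i. F i \<in> ops R" "\<forall>i\<ge>k. \<exists>r\<in>R. \<exists>a. F i = (\<lambda>z. r * z * a)" for k F
    using that
  proof (induction k arbitrary: F)
    case 0
    then have "\<forall>i. \<exists>r a. r \<in> R \<and> F i = (\<lambda>z. r * z * a)" by blast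
    then obtain r a where r: "\<And>i. r i \<in> R" and F: "F = (\<lambda>i z. r i * z * a i)" by metis
    show ?case unfolding F by (rule simple) (rule r)
  next
    case (Suc k)
    have "?\<Phi> (F(k := P)) = 0" if "P \<in> ops R" for P
      using that
    proof induction
      case (simple r a)
      have "(F(k := \<lambda>z. r * z * a)) i \<in> ops R" for i
        using Suc.prems(1) simple by (simp add: ops.simple)
      moreover have "\<exists>r'\<in>R. \<exists>a'. (F(k := \<lambda>z. r * z * a)) i = (\<lambda>z. r' * z * a')" if "i \<ge> k" for i
        using Suc.prems(2) simple that by (cases "i = k") auto
      ultimately show ?case by (intro Suc.IH) auto
    next
      case (add P Q)
      show ?case
      proof (cases "k < d")
        case True
        have "?\<Phi> (F(k := \<lambda>z. P z + Q z)) = ?\<Phi> (F(k := P)) + ?\<Phi> (F(k := Q))"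
          unfolding sum.distrib [symmetric]
        proof (intro sum.cong refl)
          fix q assume "q \<in> {q. distinct q \<and> set q = {..<d}}"
          then have "fold (F(k := \<lambda>z. P z + Q z)) q z = fold (F(k := P)) q z + fold (F(k := Q)) q z"
            using Suc.prems(1) True by (intro fold_add_at ops_lin [of _ R]) auto
          then show "sc (c q) (fold (F(k := \<lambda>z. P z + Q z)) q z) =
              sc (c q) (fold (F(k := P)) q z) + sc (c q) (fold (F(k := Q)) q z)"
            by (simp only: scale_right_distrib)
        qed
        also have "\<dots> = 0" by (simp only: add.IH add_0_left)
        finally show ?thesis .
      next
        case False
        have "fold (F(k := A)) q z = fold F q z" if "set q = {..<d}" for q A
          using that False by (intro fold_cong) auto
        then have eq: "?\<Phi> (F(k := A)) = ?\<Phi> F" for A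
          by (intro sum.cong) auto
        show ?thesis using add.IH(1) unfolding eq .
      qed
    qed
    from this [of "F k"] Suc.prems show ?case by (simp only: fun_upd_triv)
  qed
  note * = this
  show ?thesis
  proof (cases "R = {}")
    case True
    have "F 0 \<notin> ops R" unfolding True
      by (rule notI, induction rule: ops.induct) auto
    with ops show ?thesis by blast
  next
    case False
    then obtain r where r: "r \<in> R" by blast
    \<comment> \<open>Operators of index at least \<open>d\<close> are never applied, so single
      terms built from \<open>r\<close> may replace them.\<close>
    define F' where "F' i = (if i < d then F i else (\<lambda>z. r * z * 1))" for i
    have "?\<Phi> F = ?\<Phi> F'"
      by (intro sum.cong refl arg_cong [of _ _ "sc _"] fold_cong) (auto simp: F'_def)
    also have "\<dots> = 0"
    proof (rule * [of _ d]; intro allI impI)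
      show "F' i \<in> ops R" for i using ops ops.simple [OF r] by (simp only: F'_def split: if_splits) blast
      show "\<exists>r\<in>R. \<exists>a. F' i = (\<lambda>z. r * z * a)" if "i \<ge> d" for i
        using that r by (intro bexI [of _ r] exI [of _ 1]) (auto simp: F'_def)
    qed
    finally show ?thesis .
  qed
qed

end

section \<open>Consequences of a polynomial identity for \<open>\<sigma>\<close> and
  \<open>\<delta>\<close>\<close>

context ore_ext
begin

lemma R_mult_right_op: "(\<lambda>z. z * a) \<in> ops R"
  using ops.simple [OF R_one, of a] by simp

lemma commutator_op: "b \<in> R \<Longrightarrow> (\<lambda>z. z * a - b * z) \<in> ops R"
  using ops.add [OF R_mult_right_op [of a] ops.simple [of "- b" R 1]] by (simp add: R_minus)

text \<open>The only order in which the operators \<open>Q 0, \<dots>, Q (d - 1)\<close> can be applied to \<open>1\<close> without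
  giving zero is the increasing one, so one coefficient of a multilinear identity is isolated.\<close>

lemma no_degree_ladder:
  assumes PI: "satisfies_PI sc"
    and comm: "\<And>a b. a \<in> R \<Longrightarrow> b \<in> R \<Longrightarrow> a * b = b * a"
    and ops: "\<And>j. Q j \<in> ops R"
    and kill: "\<And>j z. z \<in> G j \<Longrightarrow> Q j z = 0"
    and raise: "\<And>j z. z \<in> G (Suc j) \<Longrightarrow> co z j \<noteq> 0 \<Longrightarrow>
      Q j z \<in> G (Suc (Suc j)) \<and> co (Q j z) (Suc j) \<noteq> 0"
  shows False
proof -
  obtain d c where c: "c [0..<d] \<noteq> (0 :: 'k)"
    and "\<And>Z. (\<Sum>q | distinct q \<and> set q = {..<d}. sc (c q) (prod_list (map Z q))) = 0"
    using multilinear_identity [OF PI] by blast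
  then have zero: "(\<Sum>q | distinct q \<and> set q = {..<d}. sc (c q) (fold Q q 1)) = 0"
    using ops comm by (intro identity_ops [where R = R]) auto
  have fold_zero: "fold Q q 0 = 0" for q
    using lin_zero [OF ops_lin [OF ops]] by (induction q) auto
  \<comment> \<open>On an element of degree exactly \<open>j\<close>, a first letter
    \<open>i > j\<close> gives zero, while \<open>i = j\<close> raises the degree and leaves a
    shorter list over \<open>{Suc j..<d}\<close>.\<close>
  have vanish: "fold Q q z = 0"
    if "distinct q" "set q = {j..<d}" "q \<noteq> [j..<d]" "z \<in> G (Suc j)" "co z j \<noteq> 0" for q j z
    using that
  proof (induction q arbitrary: j z)
    case Nil
    then show ?case by auto
  next
    case (Cons i q)
    have i: "j \<le> i" "i < d" using Cons.prems(2) by (metis atLeastLessThan_iff list.set_intros(1))+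
    show ?case
    proof (cases "i = j")
      case True
      have "set q = insert j (set q) - {j}" using Cons.prems(1) True by auto
      also have "\<dots> = {j..<d} - {j}" using Cons.prems(2) True by simp
      also have "\<dots> = {Suc j..<d}" by auto
      finally have "set q = {Suc j..<d}" .
      moreover have "q \<noteq> [Suc j..<d]" using Cons.prems(3) True i by (auto simp: upt_conv_Cons)
      ultimately show ?thesis
        using Cons.IH [of "Suc j" "Q j z"] Cons.prems raise True by simp
    next
      case False
      then have "z \<in> G i" using Cons.prems(4) i G_mono [of "Suc j" i] by simp
      then show ?thesis by (simp add: kill fold_zero)
    qed
  qed
  have nonzero: "fold Q [j..<d] z \<noteq> 0" if "j \<le> d" "z \<in> G (Suc j)" "co z j \<noteq> 0" for j z
    using that
  proof (induction j arbitrary: z rule: inc_induct)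
    case base
    then show ?case using co_zero_G [OF G_zero, of 0 d] by auto
  next
    case (step j)
    have "fold Q [Suc j..<d] (Q j z) \<noteq> 0"
      using step.IH [of "Q j z"] raise step.prems by blast
    then show ?case using step.hyps by (simp add: upt_conv_Cons)
  qed
  have one: "1 \<in> G (Suc 0)" "co 1 0 \<noteq> 0"
    using R_one G_1 co_monom [OF R_one, of 0 0] by auto
  have fin: "finite {q. distinct q \<and> set q = {..<d}}"
    by (rule finite_subset [OF _ finite_lists_length_le [of "{..<d}" d]])
      (use distinct_card in fastforce)+
  have "(\<Sum>q | distinct q \<and> set q = {..<d}. sc (c q) (fold Q q 1)) =
      sc (c [0..<d]) (fold Q [0..<d] 1)"
  proof (subst sum.remove [OF fin, of "[0..<d]"])
    show "[0..<d] \<in> {q. distinct q \<and> set q = {..<d}}" by (auto simp: atLeast0LessThan)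
    have "(\<Sum>q\<in>{q. distinct q \<and> set q = {..<d}} - {[0..<d]}. sc (c q) (fold Q q 1)) = 0"
      using vanish [of _ 0 1] one by (intro sum.neutral) (auto simp: atLeast0LessThan)
    then show "sc (c [0..<d]) (fold Q [0..<d] 1) +
        (\<Sum>q\<in>{q. distinct q \<and> set q = {..<d}} - {[0..<d]}. sc (c q) (fold Q q 1)) =
        sc (c [0..<d]) (fold Q [0..<d] 1)" by simp
  qed
  with zero c nonzero [of 0 1] one show False by simp
qed

text \<open>For commutative \<open>R\<close>, the factor for \<open>l\<close> multiplies a leading
  coefficient in degree \<open>n\<close> by
  \<open>(\<sigma> ^^ n) (\<alpha> l) - (\<sigma> ^^ l) (\<alpha> l)\<close>, so it removes a top
  term in degree \<open>l\<close>. The highest factor acts first: \<open>ladder \<alpha> j\<close>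
  clears the degrees from \<open>j - 1\<close> down to \<open>0\<close>.\<close>

primrec ladder :: "(nat \<Rightarrow> 'h) \<Rightarrow> nat \<Rightarrow> 'h \<Rightarrow> 'h" where
  "ladder \<alpha> 0 z = z"
| "ladder \<alpha> (Suc l) z = ladder \<alpha> l (z * \<alpha> l - (\<sigma> ^^ l) (\<alpha> l) * z)"

lemma G_reduce: "z \<in> G (Suc n) \<Longrightarrow> co z n = 0 \<Longrightarrow> z \<in> G n"
  using G_leading by fastforce

lemma co_0: "a \<in> R \<Longrightarrow> co a 0 = a"
  using co_monom [of a 0 0] by simp

lemma twisted_commutator_leading:
  assumes comm: "\<And>a b. a \<in> R \<Longrightarrow> b \<in> R \<Longrightarrow> a * b = b * a"
    and a: "a \<in> R" and z: "z \<in> G (Suc n)"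
  shows "z * a - (\<sigma> ^^ l) a * z \<in> G (Suc n)"
    "co (z * a - (\<sigma> ^^ l) a * z) n = co z n * ((\<sigma> ^^ n) a - (\<sigma> ^^ l) a)"
proof -
  have aG: "a \<in> G (Suc 0)" using a G_1 by simp
  have s: "(\<sigma> ^^ l) a \<in> R" using a by (rule \<sigma>_pow_closed)
  have za: "z * a \<in> G (Suc n)" "co (z * a) n = co z n * (\<sigma> ^^ n) a"
    using co_mult_leading [OF z aG] a by (simp_all add: co_0)
  have sz: "- (\<sigma> ^^ l) a * z \<in> G (Suc n)" using z s by (intro G_left R_minus)
  show "z * a - (\<sigma> ^^ l) a * z \<in> G (Suc n)" using G_add [OF za(1) sz] by simp
  have "co (z * a + - (\<sigma> ^^ l) a * z) n = co (z * a) n + co (- (\<sigma> ^^ l) a * z) n"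
    by (rule co_add [OF G_subset_B [OF za(1)] G_subset_B [OF sz]])
  also have "co (- (\<sigma> ^^ l) a * z) n = - (\<sigma> ^^ l) a * co z n"
    using s z by (intro co_left R_minus G_subset_B)
  finally show "co (z * a - (\<sigma> ^^ l) a * z) n = co z n * ((\<sigma> ^^ n) a - (\<sigma> ^^ l) a)"
    using za(2) comm [OF s co_closed [OF G_subset_B [OF z], of n]] by (simp add: algebra_simps)
qed

lemma ladder_kill:
  assumes comm: "\<And>a b. a \<in> R \<Longrightarrow> b \<in> R \<Longrightarrow> a * b = b * a"
    and \<alpha>: "\<And>l. \<alpha> l \<in> R"
  shows "z \<in> G j \<Longrightarrow> ladder \<alpha> j z = 0"
proof (induction j arbitrary: z)
  case 0
  then show ?case by (simp add: G_0)
next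
  case (Suc j)
  then show ?case
    using twisted_commutator_leading [OF comm \<alpha> [of j] Suc.prems, where l = j] by (simp add: G_reduce)
qed

lemma ladder_leading:
  assumes comm: "\<And>a b. a \<in> R \<Longrightarrow> b \<in> R \<Longrightarrow> a * b = b * a"
    and dom: "\<And>a b. a \<in> R \<Longrightarrow> b \<in> R \<Longrightarrow> a * b = 0 \<Longrightarrow> a = 0 \<or> b = 0"
    and \<alpha>: "\<And>l. \<alpha> l \<in> R"
  shows "(\<And>l. l < k \<Longrightarrow> (\<sigma> ^^ j) (\<alpha> l) \<noteq> (\<sigma> ^^ l) (\<alpha> l)) \<Longrightarrow> z \<in> G (Suc j) \<Longrightarrow> co z j \<noteq> 0 \<Longrightarrow>
    ladder \<alpha> k z \<in> G (Suc j) \<and> co (ladder \<alpha> k z) j \<noteq> 0"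
proof (induction k arbitrary: z)
  case 0
  then show ?case by simp
next
  case (Suc k)
  let ?z = "z * \<alpha> k - (\<sigma> ^^ k) (\<alpha> k) * z"
  note lead = twisted_commutator_leading [OF comm \<alpha> [of k] Suc.prems(2), where l = k]
  have "(\<sigma> ^^ j) (\<alpha> k) - (\<sigma> ^^ k) (\<alpha> k) \<noteq> 0" using Suc.prems(1) [of k] by simp
  moreover have "(\<sigma> ^^ j) (\<alpha> k) - (\<sigma> ^^ k) (\<alpha> k) \<in> R" by (intro R_diff \<sigma>_pow_closed \<alpha>)
  moreover have "co z j \<in> R" using Suc.prems(2) by (intro co_closed G_subset_B)
  ultimately have "co ?z j \<noteq> 0"
    using lead(2) dom Suc.prems(3) by metis
  with Suc lead(1) show ?case by simp
qed

lemma ladder_op: "(\<And>l. \<alpha> l \<in> R) \<Longrightarrow> ladder \<alpha> k \<in> ops R"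
proof (induction k)
  case 0
  then show ?case using R_mult_right_op [of 1] by (simp add: fun_eq_iff)
next
  case (Suc k)
  then have "ladder \<alpha> k \<in> ops R" "(\<sigma> ^^ k) (\<alpha> k) \<in> R" using \<sigma>_pow_closed by blast+
  from ops_comp [OF subalg_R this(1) commutator_op [OF this(2), of "\<alpha> k"]]
  show ?case by simp
qed

text \<open>Otherwise, for all \<open>l < j\<close>, the powers \<open>\<sigma> ^^ j\<close> and
  \<open>\<sigma> ^^ l\<close> differ at some \<open>\<alpha> j l\<close>. The ladder on these
  elements kills degree less than \<open>j\<close> and keeps degree \<open>j\<close>; a factor
  \<open>y\<close> on the right then raises the degree.\<close>

lemma PI_imp_finite_order:
  assumes PI: "satisfies_PI sc"
    and comm: "\<And>a b. a \<in> R \<Longrightarrow> b \<in> R \<Longrightarrow> a * b = b * a"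
    and dom: "\<And>a b. a \<in> R \<Longrightarrow> b \<in> R \<Longrightarrow> a * b = 0 \<Longrightarrow> a = 0 \<or> b = 0"
  shows "\<exists>m>0. \<forall>a\<in>R. (\<sigma> ^^ m) a = a"
proof (rule ccontr)
  assume inf: "\<not> ?thesis"
  have ex: "\<exists>a\<in>R. l < j \<longrightarrow> (\<sigma> ^^ j) a \<noteq> (\<sigma> ^^ l) a" for j l
  proof (cases "l < j")
    case True
    then obtain a where a: "a \<in> R" "(\<sigma> ^^ (j - l)) a \<noteq> a"
      using inf by (meson zero_less_diff)
    have "(\<sigma> ^^ j) a = (\<sigma> ^^ l) ((\<sigma> ^^ (j - l)) a)"
      using True by (metis comp_apply funpow_add le_add_diff_inverse less_imp_le)
    then have "(\<sigma> ^^ j) a \<noteq> (\<sigma> ^^ l) a"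
      using a bij_\<sigma>_pow [of l] \<sigma>_pow_closed [OF a(1)] by (auto simp: bij_betw_def inj_on_def)
    with a show ?thesis by blast
  next
    case False
    then show ?thesis using R_one by auto
  qed
  then have "\<forall>j l. \<exists>a. a \<in> R \<and> (l < j \<longrightarrow> (\<sigma> ^^ j) a \<noteq> (\<sigma> ^^ l) a)" by blast
  then obtain \<alpha> where \<alpha>: "\<And>j l. \<alpha> j l \<in> R"
    and ne: "\<And>j l. l < j \<Longrightarrow> (\<sigma> ^^ j) (\<alpha> j l) \<noteq> (\<sigma> ^^ l) (\<alpha> j l)" by metis
  show False
  proof (rule no_degree_ladder [OF PI comm, where Q = "\<lambda>j z. ladder (\<alpha> j) j z * y"])
    show "(\<lambda>z. ladder (\<alpha> j) j z * y) \<in> ops R" for j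
      using ops_comp [OF subalg_R R_mult_right_op [of y] ladder_op [of "\<alpha> j" j]] \<alpha> by simp
    show "ladder (\<alpha> j) j z * y = 0" if "z \<in> G j" for j z
      using ladder_kill [of "\<alpha> j", OF comm \<alpha> that] by simp
    show "ladder (\<alpha> j) j z * y \<in> G (Suc (Suc j)) \<and> co (ladder (\<alpha> j) j z * y) (Suc j) \<noteq> 0"
      if "z \<in> G (Suc j)" "co z j \<noteq> 0" for j z
    proof -
      let ?z = "ladder (\<alpha> j) j z"
      have z: "?z \<in> G (Suc j)" "co ?z j \<noteq> 0"
        using ladder_leading [of "\<alpha> j" j j z] comm dom \<alpha> ne that by auto
      have "co y (Suc 0) = 1" using co_monom [OF R_one, of 1 1] by simp
      with z co_mult_leading [OF z(1) y_in_G] show ?thesis by (simp add: \<sigma>_pow_one)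
    qed
  qed
qed

text \<open>As in the Leibniz rule, each of the \<open>Suc n\<close> factors \<open>y\<close>
  contributes \<open>\<delta> a * y ^ n\<close> modulo lower degree.\<close>

lemma y_pow_commutator:
  assumes id: "\<And>a. a \<in> R \<Longrightarrow> \<sigma> a = a" and a: "a \<in> R"
  shows "y ^ Suc n * a - a * y ^ Suc n - of_nat (Suc n) * \<delta> a * y ^ n \<in> G n"
proof (induction n)
  case 0
  then show ?case using comm [OF a] a by (simp add: id G_0)
next
  case (Suc n)
  let ?g = "y ^ Suc n * a - a * y ^ Suc n - of_nat (Suc n) * \<delta> a * y ^ n"
  have ofn: "of_nat m * b \<in> R" if "b \<in> R" for m b
    using that by (induction m) (auto simp: algebra_simps R_zero R_add)
  have y_of_nat: "y * (of_nat m * b) = of_nat m * (y * b)" for m b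
    by (metis mult.assoc mult_of_nat_commute)
  have "y ^ Suc (Suc n) * a = y * (y ^ Suc n * a)" by (simp add: mult.assoc)
  also have "\<dots> = y * (a * y ^ Suc n + of_nat (Suc n) * \<delta> a * y ^ n + ?g)" by simp
  also have "\<dots> = (y * a) * y ^ Suc n + of_nat (Suc n) * (y * \<delta> a) * y ^ n + y * ?g"
    by (simp only: distrib_left mult.assoc y_of_nat)
  also have "\<dots> = (a * y + \<delta> a) * y ^ Suc n + of_nat (Suc n) * (\<delta> a * y + \<delta> (\<delta> a)) * y ^ n + y * ?g"
    using a by (simp only: comm \<delta>_closed id)
  finally have "y ^ Suc (Suc n) * a - a * y ^ Suc (Suc n) - of_nat (Suc (Suc n)) * \<delta> a * y ^ Suc n =
      of_nat (Suc n) * \<delta> (\<delta> a) * y ^ n + y * ?g"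
    by (simp add: algebra_simps)
  also have "\<dots> \<in> G (Suc n)"
    using Suc a by (intro G_add monom_in_G y_G ofn \<delta>_closed)
  finally show ?case .
qed

text \<open>With \<open>\<sigma>\<close> trivial, the commutator with \<open>a\<close> acts on
  leading terms like differentiation in \<open>y\<close>, times \<open>\<delta> a\<close>.\<close>

lemma commutator_leading:
  assumes id: "\<And>a. a \<in> R \<Longrightarrow> \<sigma> a = a" and a: "a \<in> R"
    and comm': "\<And>a b. a \<in> R \<Longrightarrow> b \<in> R \<Longrightarrow> a * b = b * a"
    and z: "z \<in> G (Suc (Suc n))"
  shows "z * a - a * z \<in> G (Suc n)"
    "co (z * a - a * z) n = of_nat (Suc n) * co z (Suc n) * \<delta> a"
proof -
  let ?r = "co z (Suc n)"
  obtain g where g: "g \<in> G (Suc n)" "z = ?r * y ^ Suc n + g" using G_leading [OF z] by blast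
  have r: "?r \<in> R" using z by (intro co_closed G_subset_B)
  have ofn: "of_nat m * b \<in> R" if "b \<in> R" for m b
    using that by (induction m) (auto simp: algebra_simps R_zero R_add)
  have pow_id: "(\<sigma> ^^ n) a = a" using a id by (induction n) auto
  have gc: "g * a - a * g \<in> G n"
    using twisted_commutator_leading [OF comm' a g(1), of 0] by (auto intro!: G_reduce simp: pow_id)
  let ?k = "y ^ Suc n * a - a * y ^ Suc n - of_nat (Suc n) * \<delta> a * y ^ n"
  have k: "?k \<in> G n" using id a by (rule y_pow_commutator)
  have "z * a - a * z = ?r * (y ^ Suc n * a) - (a * ?r) * y ^ Suc n + (g * a - a * g)"
    using g(2) by (metis (no_types, lifting) add_diff_add distrib_left distrib_right mult.assoc)
  also have "\<dots> = ?r * (y ^ Suc n * a - a * y ^ Suc n) + (g * a - a * g)"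
    using comm' [OF a r] by (simp add: right_diff_distrib mult.assoc [symmetric])
  also have "\<dots> = ?r * (of_nat (Suc n) * \<delta> a * y ^ n + ?k) + (g * a - a * g)" by simp
  also have "\<dots> = (?r * (of_nat (Suc n) * \<delta> a)) * y ^ n + (?r * ?k + (g * a - a * g))"
    by (simp only: distrib_left mult.assoc add.assoc)
  also have "?r * (of_nat (Suc n) * \<delta> a) = of_nat (Suc n) * ?r * \<delta> a"
    by (metis mult.assoc mult_of_nat_commute)
  finally have eq: "z * a - a * z = of_nat (Suc n) * ?r * \<delta> a * y ^ n + (?r * ?k + (g * a - a * g))" .
  have c: "of_nat (Suc n) * ?r * \<delta> a \<in> R" using r a by (intro R_mult ofn \<delta>_closed)
  have low: "?r * ?k + (g * a - a * g) \<in> G n" using r k gc by (intro G_add G_left)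
  show "z * a - a * z \<in> G (Suc n)" unfolding eq G_Suc using c low by blast
  show "co (z * a - a * z) n = of_nat (Suc n) * co z (Suc n) * \<delta> a"
    unfolding eq using c low by (rule co_leading)
qed

text \<open>If \<open>\<delta> a\<close> were nonzero, the commutator with \<open>a\<close> would
  lower every positive degree by exactly one, since the factors \<open>Suc n\<close> do not vanish.
  Its \<open>j\<close>-th power kills degree less than \<open>j\<close> and sends degree
  \<open>j\<close> to nonzero elements of \<open>R\<close>; right multiplication by
  \<open>y ^ Suc j\<close> gives the operators for \<open>no_degree_ladder\<close>.\<close>

lemma PI_imp_zero_derivation:
  assumes PI: "satisfies_PI sc"
    and char: "\<And>n. n > 0 \<Longrightarrow> of_nat n \<noteq> (0 :: 'k)"
    and comm': "\<And>a b. a \<in> R \<Longrightarrow> b \<in> R \<Longrightarrow> a * b = b * a"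
    and dom: "\<And>a b. a \<in> R \<Longrightarrow> b \<in> R \<Longrightarrow> a * b = 0 \<Longrightarrow> a = 0 \<or> b = 0"
    and id: "\<And>a. a \<in> R \<Longrightarrow> \<sigma> a = a" and a: "a \<in> R"
  shows "\<delta> a = 0"
proof (rule ccontr)
  assume \<delta>a: "\<delta> a \<noteq> 0"
  let ?\<rho> = "\<lambda>z. z * a - a * z"
  have of_nat_sc: "of_nat n * b = sc (of_nat n) b" for n b
    by (induction n) (auto simp: algebra_simps scale_left_distrib)
  have pow_id: "(\<sigma> ^^ n) a = a" for n using a id by (induction n) auto
  have kill: "(?\<rho> ^^ j) z = 0" if "z \<in> G j" for j z
    using that
  proof (induction j arbitrary: z)
    case 0
    then show ?case by (simp add: G_0)
  next
    case (Suc j)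
    have "?\<rho> z \<in> G j"
      using twisted_commutator_leading [OF comm' a Suc.prems, of 0]
      by (auto intro!: G_reduce simp: pow_id)
    with Suc.IH show ?case by (simp only: funpow_Suc_right comp_apply)
  qed
  have lead: "\<exists>s\<in>R. s \<noteq> 0 \<and> (?\<rho> ^^ j) z = s" if "z \<in> G (Suc j)" "co z j \<noteq> 0" for j z
    using that
  proof (induction j arbitrary: z)
    case 0
    then show ?case using co_0 by (auto simp: G_1)
  next
    case (Suc j)
    have l: "z * a - a * z \<in> G (Suc j)"
      "co (z * a - a * z) j = of_nat (Suc j) * co z (Suc j) * \<delta> a"
      using commutator_leading [of a z j] id a comm' Suc.prems(1) by blast+
    have c: "co z (Suc j) \<in> R" using Suc.prems(1) by (intro co_closed G_subset_B)
    have "co z (Suc j) * \<delta> a \<noteq> 0" using dom [OF c \<delta>_closed [OF a]] Suc.prems(2) \<delta>a by blast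
    moreover have "co (z * a - a * z) j = sc (of_nat (Suc j)) (co z (Suc j) * \<delta> a)"
      using l(2) by (simp only: of_nat_sc sc_mult_left)
    ultimately have "co (z * a - a * z) j \<noteq> 0"
      using char [of "Suc j"] by (simp del: of_nat_Suc)
    from Suc.IH [OF l(1) this] show ?case by (simp only: funpow_Suc_right comp_apply)
  qed
  have pow_op: "?\<rho> ^^ j \<in> ops R" for j
  proof (induction j)
    case 0
    then show ?case using R_mult_right_op [of 1] by (simp add: id_def)
  next
    case (Suc j)
    from ops_comp [OF subalg_R commutator_op [OF a, of a] Suc] show ?case by (simp add: comp_def)
  qed
  show False
  proof (rule no_degree_ladder [OF PI comm', where Q = "\<lambda>j z. (?\<rho> ^^ j) z * y ^ Suc j"])
    show "(\<lambda>z. (?\<rho> ^^ j) z * y ^ Suc j) \<in> ops R" for j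
      by (rule ops_comp [OF subalg_R R_mult_right_op pow_op])
    show "(?\<rho> ^^ j) z * y ^ Suc j = 0" if "z \<in> G j" for j z
      using kill [OF that] by simp
    show "(?\<rho> ^^ j) z * y ^ Suc j \<in> G (Suc (Suc j)) \<and> co ((?\<rho> ^^ j) z * y ^ Suc j) (Suc j) \<noteq> 0"
      if z: "z \<in> G (Suc j)" "co z j \<noteq> 0" for j z
    proof -
      obtain s where "s \<in> R" "s \<noteq> 0" "(?\<rho> ^^ j) z = s" using lead [OF z] by blast
      then show ?thesis using monom_in_G [of s "Suc j"] co_monom [of s "Suc j"] by simp
    qed
  qed
qed

end

section \<open>Slices of the comultiplication\<close>

locale hopf_alg =
  fixes sc :: "'k::field \<Rightarrow> 'h::ring_1 \<Rightarrow> 'h" and D :: "'h \<Rightarrow> ('h \<times> 'h) list"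
    and e :: "'h \<Rightarrow> 'k" and S :: "'h \<Rightarrow> 'h"
  assumes hopf: "hopf_algebra sc D e S"
begin

sublocale k_alg sc
  using hopf by unfold_locales (simp add: hopf_algebra_def)

lemma linf_e: "linf e" and lin_S: "lin S"
  using hopf unfolding hopf_algebra_def linf_def lin_def by (auto simp: Vector_Spaces.linear_iff)

lemma e_mult: "e (a * b) = e a * e b" and e_one: "e 1 = 1"
  using hopf unfolding hopf_algebra_def by auto

lemma bilin_multilin: "bilin G \<Longrightarrow> multilin 2 (\<lambda>u. G (u ! 0) (u ! 1))"
  unfolding multilin_def
proof (intro allI impI)
  fix u :: "'h list" and i :: nat assume G: "bilin G" and "length u = 2 \<and> i < 2"
  then have "length u = 2" "i = 0 \<or> i = 1" by auto
  then show "(\<forall>a b. G (u[i := a + b] ! 0) (u[i := a + b] ! 1) =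
        G (u[i := a] ! 0) (u[i := a] ! 1) + G (u[i := b] ! 0) (u[i := b] ! 1)) \<and>
      (\<forall>c a. G (u[i := sc c a] ! 0) (u[i := sc c a] ! 1) = sc c (G (u[i := a] ! 0) (u[i := a] ! 1)))"
    using G by (auto simp: bilin_def lin_def)
qed

lemma teq2_eval:
  assumes "teq2 sc xs ys" "bilin G"
  shows "sum_list (map (\<lambda>(x, y). G x y) xs) = sum_list (map (\<lambda>(x, y). G x y) ys)"
  using teq_eval [OF assms(1) bilin_multilin [OF assms(2)]]
  by (simp add: pt_def comp_def case_prod_unfold)

definition Dsum :: "('h \<Rightarrow> 'h \<Rightarrow> 'h) \<Rightarrow> 'h \<Rightarrow> 'h" where
  "Dsum G a = sum_list (map (\<lambda>(x, y). G x y) (D a))"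

text \<open>\<open>Dsum G a\<close> is \<open>\<Sum> G a\<^sub>1 a\<^sub>2\<close>, hence \<open>T f = (f \<otimes> 1) \<Delta>\<close> and \<open>U f = (1 \<otimes> f) \<Delta>\<close>.\<close>

definition T :: "('h \<Rightarrow> 'k) \<Rightarrow> 'h \<Rightarrow> 'h" where
  "T f = Dsum (\<lambda>x y. sc (f x) y)"

definition U :: "('h \<Rightarrow> 'k) \<Rightarrow> 'h \<Rightarrow> 'h" where
  "U f = Dsum (\<lambda>x y. sc (f y) x)"

lemma Dsum_add: "bilin G \<Longrightarrow> Dsum G (a + b) = Dsum G a + Dsum G b"
  using teq2_eval [of "D (a + b)" "D a @ D b" G] hopf by (simp add: Dsum_def hopf_algebra_def)

lemma Dsum_scale: "bilin G \<Longrightarrow> Dsum G (sc c a) = sc c (Dsum G a)"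
proof -
  assume G: "bilin G"
  have "Dsum G (sc c a) = sum_list (map (\<lambda>(x, y). G x y) (map (\<lambda>(x, y). (sc c x, y)) (D a)))"
    unfolding Dsum_def using hopf G by (intro teq2_eval) (simp_all add: hopf_algebra_def)
  also have "\<dots> = sum_list (map (\<lambda>p. sc c (G (fst p) (snd p))) (D a))"
    using G by (simp add: comp_def case_prod_unfold bilin_def lin_def)
  also have "\<dots> = sc c (Dsum G a)"
    using lin_sum_list [of "sc c" "\<lambda>p. G (fst p) (snd p)" "D a"]
    by (simp add: Dsum_def case_prod_unfold lin_def scale_right_distrib mult.commute)
  finally show ?thesis .
qed

lemma lin_Dsum: "bilin G \<Longrightarrow> lin (Dsum G)"
  by (simp add: lin_def Dsum_add Dsum_scale)

lemma sum_list_map_concat: "sum_list (map f (concat xss)) = sum_list (map (\<lambda>xs. sum_list (map f xs)) xss)"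
  for f :: "'b \<Rightarrow> 'h"
  by (induction xss) auto

lemma Dsum_mult:
  assumes "bilin G"
  shows "Dsum G (a * b) = Dsum (\<lambda>x y. Dsum (\<lambda>u v. G (x * u) (y * v)) b) a"
proof -
  have "teq2 sc (D (a * b)) [(x * u, y * v). (x, y) \<leftarrow> D a, (u, v) \<leftarrow> D b]"
    using hopf by (simp add: hopf_algebra_def)
  from teq2_eval [OF this assms] show ?thesis
    by (simp add: Dsum_def sum_list_map_concat comp_def case_prod_unfold)
qed

lemma Dsum_one: "bilin G \<Longrightarrow> Dsum G 1 = G 1 1"
  using teq2_eval [of "D 1" "[(1, 1)]" G] hopf by (simp add: Dsum_def hopf_algebra_def)

definition trilin :: "('h \<Rightarrow> 'h \<Rightarrow> 'h \<Rightarrow> 'h) \<Rightarrow> bool" where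
  "trilin G \<longleftrightarrow> (\<forall>x y. lin (G x y)) \<and> (\<forall>x z. lin (\<lambda>y. G x y z)) \<and> (\<forall>y z. lin (\<lambda>x. G x y z))"

lemma trilin_multilin: "trilin G \<Longrightarrow> multilin 3 (\<lambda>u. G (u ! 0) (u ! 1) (u ! 2))"
  unfolding multilin_def
proof (intro allI impI)
  fix u :: "'h list" and i :: nat assume G: "trilin G" and "length u = 3 \<and> i < 3"
  then have "length u = 3" "i = 0 \<or> i = 1 \<or> i = 2" by auto
  then show "(\<forall>a b. G (u[i := a + b] ! 0) (u[i := a + b] ! 1) (u[i := a + b] ! 2) =
        G (u[i := a] ! 0) (u[i := a] ! 1) (u[i := a] ! 2) + G (u[i := b] ! 0) (u[i := b] ! 1) (u[i := b] ! 2)) \<and>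
      (\<forall>c a. G (u[i := sc c a] ! 0) (u[i := sc c a] ! 1) (u[i := sc c a] ! 2) =
        sc c (G (u[i := a] ! 0) (u[i := a] ! 1) (u[i := a] ! 2)))"
    using G by (auto simp: trilin_def lin_def)
qed

lemma Dsum_coassoc:
  assumes "trilin G"
  shows "Dsum (\<lambda>x z. Dsum (\<lambda>u v. G u v z) x) a = Dsum (\<lambda>x z. Dsum (\<lambda>u v. G x u v) z) a"
proof -
  have "teq sc 3 [[x, y, b]. (a', b) \<leftarrow> D a, (x, y) \<leftarrow> D a'] [[a', x, y]. (a', b) \<leftarrow> D a, (x, y) \<leftarrow> D b]"
    using hopf by (simp add: hopf_algebra_def)
  from teq_eval [OF this trilin_multilin [OF assms]] show ?thesis
    by (simp add: Dsum_def sum_list_map_concat comp_def case_prod_unfold)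
qed

lemma Dsum_minus: "Dsum (\<lambda>x y. G x y - G' x y) a = Dsum G a - Dsum G' a"
  unfolding Dsum_def by (simp add: case_prod_unfold sum_list_subtractf)

lemma lin_Dsum_param:
  assumes "\<And>u v. lin (\<lambda>x. K x u v)"
  shows "lin (\<lambda>x. Dsum (K x) a)"
proof -
  have "sum_list (map (\<lambda>p. sc c (K x (fst p) (snd p))) xs) = sc c (sum_list (map (\<lambda>p. K x (fst p) (snd p)) xs))"
    for c x xs by (induction xs) (auto simp: scale_right_distrib)
  then show ?thesis
    using assms by (simp add: lin_def Dsum_def case_prod_unfold sum_list_addf)
qed

lemma Dsum_lin_out: "lin F \<Longrightarrow> F (Dsum G a) = Dsum (\<lambda>x y. F (G x y)) a"
  unfolding Dsum_def by (simp add: lin_sum_list case_prod_unfold)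

lemma bilin_T: "linf f \<Longrightarrow> bilin (\<lambda>x y. sc (f x) y)"
  and bilin_U: "linf f \<Longrightarrow> bilin (\<lambda>x y. sc (f y) x)"
  by (auto simp: bilin_def lin_def linf_def scale_right_distrib scale_left_distrib mult.commute)

lemma lin_T: "linf f \<Longrightarrow> lin (T f)" and lin_U: "linf f \<Longrightarrow> lin (U f)"
  unfolding T_def U_def by (simp_all add: lin_Dsum bilin_T bilin_U)

lemma T_e: "T e a = a" and U_e: "U e a = a"
  using hopf unfolding T_def U_def Dsum_def hopf_algebra_def by blast+

lemma antipode: "Dsum (\<lambda>x y. S x * y) a = sc (e a) 1"
  using hopf unfolding Dsum_def hopf_algebra_def by blast

lemma Dsum_expand:
  obtains bs \<beta> where "finite bs" "\<And>b. linf (\<beta> b)" "\<And>G. bilin G \<Longrightarrow> Dsum G a = (\<Sum>b\<in>bs. G b (T (\<beta> b) a))"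
  using bilin_expand [of "D a"] unfolding Dsum_def T_def by blast

text \<open>Membership of \<open>\<Delta> a\<close> in \<open>H \<otimes> W\<close>, expressed through slices.\<close>

definition rsupp :: "'h \<Rightarrow> 'h set \<Rightarrow> bool" where
  "rsupp a W \<longleftrightarrow> (\<forall>f. linf f \<longrightarrow> T f a \<in> W)"

text \<open>Expanding first factors in a basis writes \<open>\<Delta> a\<close> as a sum of terms
  \<open>b \<otimes> T (\<beta> b) a\<close>, with all second factors in \<open>W\<close>.\<close>

lemma Dsum_mem:
  assumes "rsupp a W" "bilin G" "subspace V" "\<And>x w. w \<in> W \<Longrightarrow> G x w \<in> V"
  shows "Dsum G a \<in> V"
proof -
  obtain bs \<beta> where "finite bs" "\<And>b. linf (\<beta> b)" "\<And>G. bilin G \<Longrightarrow> Dsum G a = (\<Sum>b\<in>bs. G b (T (\<beta> b) a))"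
    by (rule Dsum_expand [of a]) blast
  then show ?thesis using assms by (auto simp: rsupp_def intro!: subspace_sum)
qed

lemma bilin_diff: "bilin G \<Longrightarrow> bilin G' \<Longrightarrow> bilin (\<lambda>x y. G x y - G' x y)"
  by (auto simp: bilin_def lin_def scale_right_diff_distrib)

lemma Dsum_cong:
  assumes "rsupp a W" "bilin G" "bilin G'" "\<And>x w. w \<in> W \<Longrightarrow> G x w = G' x w"
  shows "Dsum G a = Dsum G' a"
  using Dsum_mem [OF assms(1) bilin_diff [OF assms(2,3)], of "{0}"] assms(4)
  by (simp add: subspace_single_0 Dsum_minus)

text \<open>Equality of all slices means
  \<open>\<Delta> a = (1 \<otimes> \<phi>) \<Delta> b\<close>, hence equality under every bilinear
  map.\<close>

lemma Dsum_transfer: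
  assumes "bilin G" "lin \<phi>" "\<And>f. linf f \<Longrightarrow> T f a = \<phi> (T f b)"
  shows "Dsum G a = Dsum (\<lambda>x z. G x (\<phi> z)) b"
proof -
  \<comment> \<open>This list represents the difference of the two tensors, with the sign in the
    first entries; all its slices vanish.\<close>
  define xs where "xs = D a @ map (\<lambda>(x, z). (- x, \<phi> z)) (D b)"
  obtain bs \<beta> where bs: "finite bs" "\<And>b. linf (\<beta> b)"
    "\<And>G. bilin G \<Longrightarrow> sum_list (map (\<lambda>(x, y). G x y) xs) =
       (\<Sum>b\<in>bs. G b (sum_list (map (\<lambda>(x, y). sc (\<beta> b x) y) xs)))"
    using bilin_expand [of xs] by blast
  have neg: "sum_list (map (\<lambda>p. - h p) ys) = - sum_list (map h ys)" for h :: "'h \<times> 'h \<Rightarrow> 'h" and ys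
    by (induction ys) auto
  have split: "sum_list (map (\<lambda>(x, y). G x y) xs) = Dsum G a - Dsum (\<lambda>x z. G x (\<phi> z)) b"
    if "bilin G" for G
  proof -
    have "G (- x) z = - G x z" for x z
      using that lin_diff [of "\<lambda>x. G x z" 0 x] lin_zero [of "\<lambda>x. G x z"] by (simp add: bilin_def)
    then show ?thesis by (simp add: xs_def Dsum_def comp_def case_prod_unfold neg)
  qed
  have "sum_list (map (\<lambda>(x, y). sc (\<beta> b' x) y) xs) = 0" for b'
  proof -
    have "Dsum (\<lambda>x z. sc (\<beta> b' x) (\<phi> z)) b = \<phi> (T (\<beta> b') b)"
      unfolding T_def using assms(2) by (simp add: Dsum_lin_out) (simp add: lin_def)
    then show ?thesis using split [OF bilin_T [OF bs(2)]] assms(3) [OF bs(2)] by (simp add: T_def)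
  qed
  moreover have "G b 0 = 0" for b using assms(1) lin_zero [of "G b"] by (simp add: bilin_def)
  ultimately have "sum_list (map (\<lambda>(x, y). G x y) xs) = 0" using bs(3) [OF assms(1)] by simp
  with split [OF assms(1)] show ?thesis by simp
qed

lemma bilin_Dsum_mult: "bilin G \<Longrightarrow> bilin (\<lambda>x y. Dsum (\<lambda>u v. G (x * u) (y * v)) b)"
  unfolding bilin_def
  by (intro conjI allI lin_Dsum_param) (auto simp: lin_def algebra_simps sc_mult_left)

lemma bilin_mult_pair: "bilin G \<Longrightarrow> bilin (\<lambda>u v. G (x * u) (y * v))"
  unfolding bilin_def by (auto simp: lin_def algebra_simps sc_mult_right)

lemma rsupp_mult:
  assumes "rsupp a V" "rsupp b W" "subspace X" "\<And>v w. v \<in> V \<Longrightarrow> w \<in> W \<Longrightarrow> v * w \<in> X"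
  shows "rsupp (a * b) X"
  unfolding rsupp_def
proof (intro allI impI)
  fix f assume f: "linf f"
  have "Dsum (\<lambda>u v. sc (f (x * u)) (w * v)) b \<in> X" if "w \<in> V" for x w
    using that assms f
    by (intro Dsum_mem [OF assms(2) bilin_mult_pair [OF bilin_T [OF f]] assms(3)] subspace_scale)
  then show "T f (a * b) \<in> X"
    unfolding T_def Dsum_mult [OF bilin_T [OF f]]
    by (intro Dsum_mem [OF assms(1) bilin_Dsum_mult [OF bilin_T [OF f]] assms(3)])
qed

lemma rsupp_add: "rsupp a W \<Longrightarrow> rsupp b W \<Longrightarrow> subspace W \<Longrightarrow> rsupp (a + b) W"
  using lin_T by (auto simp: rsupp_def lin_def subspace_add)

lemma rsupp_mono: "rsupp a W \<Longrightarrow> W \<subseteq> V \<Longrightarrow> rsupp a V"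
  by (auto simp: rsupp_def)

lemma rsupp_scalar: "subspace W \<Longrightarrow> 1 \<in> W \<Longrightarrow> rsupp (sc c 1) W"
  using lin_T by (auto simp: rsupp_def T_def Dsum_one Dsum_scale bilin_T intro!: subspace_scale)

text \<open>Multiplicativity is asked only on the second factors that occur, since functionals
  reading off a leading coefficient are multiplicative only below a degree bound.\<close>

lemma U_mult:
  assumes ab: "rsupp a V" "rsupp b W" and L: "linf L" "linf L'" "linf L''"
    and mult: "\<And>v w. v \<in> V \<Longrightarrow> w \<in> W \<Longrightarrow> L'' (v * w) = L v * L' w"
  shows "U L'' (a * b) = U L a * U L' b"
proof -
  have "U L'' (a * b) = Dsum (\<lambda>x y. Dsum (\<lambda>u v. sc (L'' (y * v)) (x * u)) b) a"
    unfolding U_def Dsum_mult [OF bilin_U [OF L(3)]] ..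
  also have "\<dots> = Dsum (\<lambda>x y. Dsum (\<lambda>u v. sc (L y * L' v) (x * u)) b) a"
  proof (rule Dsum_cong [OF ab(1)])
    show "bilin (\<lambda>x y. Dsum (\<lambda>u v. sc (L'' (y * v)) (x * u)) b)"
      using bilin_Dsum_mult [OF bilin_U [OF L(3)]] .
    show "bilin (\<lambda>x y. Dsum (\<lambda>u v. sc (L y * L' v) (x * u)) b)"
      unfolding bilin_def using L
      by (intro conjI allI lin_Dsum_param)
        (auto simp: lin_def linf_def algebra_simps sc_mult_left scale_right_distrib scale_left_distrib)
    fix x w assume w: "w \<in> V"
    show "Dsum (\<lambda>u v. sc (L'' (w * v)) (x * u)) b = Dsum (\<lambda>u v. sc (L w * L' v) (x * u)) b"
    proof (rule Dsum_cong [OF ab(2)])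
      show "bilin (\<lambda>u v. sc (L'' (w * v)) (x * u))"
        using bilin_mult_pair [OF bilin_U [OF L(3)]] .
      show "bilin (\<lambda>u v. sc (L w * L' v) (x * u))"
        unfolding bilin_def using L
        by (auto simp: lin_def linf_def algebra_simps sc_mult_right scale_right_distrib scale_left_distrib)
    qed (simp add: mult w)
  qed
  also have "\<dots> = Dsum (\<lambda>x y. sc (L y) x * U L' b) a"
  proof -
    have l: "lin (\<lambda>z. sc (L y) x * z)" for x y by (simp add: lin_def distrib_left sc_mult_right)
    have "sc (L y) x * U L' b = Dsum (\<lambda>u v. sc (L y * L' v) (x * u)) b" for x y
      unfolding U_def Dsum_lin_out [OF l] by (simp add: sc_mult_left sc_mult_right mult.commute)
    then show ?thesis by simp
  qed
  also have "\<dots> = U L a * U L' b"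
  proof -
    have "lin (\<lambda>z. z * U L' b)" by (simp add: lin_def distrib_right sc_mult_left)
    from Dsum_lin_out [OF this] show ?thesis unfolding U_def [of L] by simp
  qed
  finally show ?thesis .
qed

text \<open>Both sides are \<open>(f \<otimes> L) \<Delta> a\<close>.\<close>

lemma functional_U: "linf f \<Longrightarrow> linf L \<Longrightarrow> f (U L a) = L (T f a)"
  unfolding U_def T_def Dsum_def
  by (simp add: linf_sum_list case_prod_unfold) (simp add: linf_def mult.commute)

text \<open>By coassociativity both sides are the twofold comultiplication of \<open>a\<close> with
  \<open>f\<close> applied to the first factor and \<open>L\<close> to the third.\<close>

lemma U_T_commute:
  assumes "linf f" "linf L"
  shows "U L (T f a) = T f (U L a)"
proof -
  have lins: "lin (U L)" "lin (T f)" using assms by (simp_all add: lin_U lin_T)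
  have l: "lin (sc c)" for c by (simp add: lin_def scale_right_distrib mult.commute)
  have "U L (T f a) = Dsum (\<lambda>x z. Dsum (\<lambda>u v. sc (f x * L v) u) z) a"
  proof -
    have "U L (T f a) = Dsum (\<lambda>x z. sc (f x) (U L z)) a"
      unfolding T_def Dsum_lin_out [OF lins(1)] using lins(1) by (simp add: lin_def)
    then show ?thesis by (simp add: U_def Dsum_lin_out [OF l])
  qed
  moreover have "T f (U L a) = Dsum (\<lambda>x z. Dsum (\<lambda>u v. sc (f u * L z) v) x) a"
  proof -
    have "T f (U L a) = Dsum (\<lambda>x z. sc (L z) (T f x)) a"
      unfolding U_def Dsum_lin_out [OF lins(2)] using lins(2) by (simp add: lin_def)
    then show ?thesis by (simp add: T_def Dsum_lin_out [OF l] mult.commute)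
  qed
  moreover have "trilin (\<lambda>p q r. sc (f p * L r) q)"
    using assms by (auto simp: trilin_def lin_def linf_def algebra_simps scale_right_distrib scale_left_distrib)
  ultimately show ?thesis using Dsum_coassoc [of "\<lambda>p q r. sc (f p * L r) q" a] by simp
qed

lemma U_zero:
  assumes "rsupp a W" "linf L" "\<And>w. w \<in> W \<Longrightarrow> L w = 0"
  shows "U L a = 0"
  using Dsum_mem [OF assms(1) bilin_U [OF assms(2)], of "{0}"] assms(3)
  by (simp add: U_def subspace_single_0)

lemma U_cong:
  assumes "rsupp a W" "linf L" "linf L'" "\<And>w. w \<in> W \<Longrightarrow> L w = L' w"
  shows "U L a = U L' a"
  unfolding U_def using assms by (intro Dsum_cong [OF assms(1)] bilin_U) auto

end

section \<open>Ore extensions of a commutative Hopf algebra\<close>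

context k_alg
begin

definition is_char :: "'h set \<Rightarrow> ('h \<Rightarrow> 'k) \<Rightarrow> bool" where
  "is_char A \<chi> \<longleftrightarrow> \<chi> 1 = 1 \<and> (\<forall>a\<in>A. \<forall>b\<in>A. \<chi> (a + b) = \<chi> a + \<chi> b \<and> \<chi> (a * b) = \<chi> a * \<chi> b) \<and>
     (\<forall>c. \<forall>a\<in>A. \<chi> (sc c a) = c * \<chi> a)"

text \<open>A substitute for generic points: characters play the part of points of the spectrum of
  \<open>A\<close>.\<close>

definition chars_separate :: "'h set \<Rightarrow> bool" where
  "chars_separate A \<longleftrightarrow> (\<forall>a\<in>A. a \<noteq> 0 \<longrightarrow> (\<exists>\<chi>. is_char A \<chi> \<and> \<chi> a \<noteq> 0))"

lemma is_char_zero: "is_char A \<chi> \<Longrightarrow> a \<in> A \<Longrightarrow> \<chi> 0 = 0"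
  unfolding is_char_def by (metis mult_zero_left scale_zero_left)

lemma subalgebra_subspace: "subalgebra A \<Longrightarrow> subspace A"
  unfolding subalgebra_def subspace_def by (metis scale_zero_left)

end

text \<open>\<open>domain\<close> and \<open>units\<close> concern the whole algebra because the
  maps \<open>U\<close> return first tensor factors, while \<open>rsupp\<close> controls only second
  ones.\<close>

locale hopf_ore = hopf_alg sc D e S + ore_ext sc R y \<sigma> \<delta>
  for sc :: "'k::field \<Rightarrow> 'h::ring_1 \<Rightarrow> 'h" and D e S R y \<sigma> \<delta> +
  assumes domain: "a * b = (0 :: 'h) \<Longrightarrow> a = 0 \<or> b = 0"
    and units: "a * b = (1 :: 'h) \<Longrightarrow> \<exists>c. a = sc c 1"
    and commR: "a \<in> R \<Longrightarrow> b \<in> R \<Longrightarrow> a * b = b * a"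
    and separate: "chars_separate R"
    and rsupp_R: "a \<in> R \<Longrightarrow> rsupp a R"
    and rsupp_y_B: "rsupp y B"
begin

text \<open>\<open>co\<close> is meaningful on \<open>B\<close> only; composing it with a linear projection onto \<open>B\<close> gives maps
  that are linear on the whole algebra, as the evaluation of tensors requires.\<close>

definition pr :: "'h \<Rightarrow> 'h" where
  "pr = (SOME g. lin g \<and> range g \<subseteq> B \<and> (\<forall>v\<in>B. g v = v))"

lemma pr: "lin pr" "pr h \<in> B" "v \<in> B \<Longrightarrow> pr v = v"
proof -
  obtain g where "lin g" "range g \<subseteq> B" "\<And>v. v \<in> B \<Longrightarrow> g v = v"
    using projection_exists [OF subalgebra_subspace [OF B_subalgebra]] by blast
  then have "\<exists>g. lin g \<and> range g \<subseteq> B \<and> (\<forall>v\<in>B. g v = v)" by blast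
  from someI_ex [OF this] show "lin pr" "pr h \<in> B" "v \<in> B \<Longrightarrow> pr v = v"
    unfolding pr_def by auto
qed

definition cf :: "nat \<Rightarrow> 'h \<Rightarrow> 'h" where
  "cf n h = co (pr h) n"

definition L :: "nat \<Rightarrow> ('h \<Rightarrow> 'k) \<Rightarrow> 'h \<Rightarrow> 'k" where
  "L n \<chi> h = \<chi> (cf n h)"

lemma lin_cf: "lin (cf n)"
  using pr unfolding lin_def cf_def by (simp add: co_add co_scale)

lemma cf_closed: "cf n h \<in> R"
  unfolding cf_def by (intro co_closed pr)

lemma cf_B: "v \<in> B \<Longrightarrow> cf n v = co v n"
  by (simp add: cf_def pr)

lemma linf_L: "is_char R \<chi> \<Longrightarrow> linf (L n \<chi>)"
  using lin_cf [of n] cf_closed unfolding linf_def lin_def L_def is_char_def by simp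

lemma L_G: "v \<in> G m \<Longrightarrow> L n \<chi> v = \<chi> (co v n)"
  by (simp add: L_def cf_B G_subset_B)

lemma L_G_zero: "is_char R \<chi> \<Longrightarrow> v \<in> G m \<Longrightarrow> m \<le> n \<Longrightarrow> L n \<chi> v = 0"
  by (simp add: L_G co_zero_G is_char_zero [OF _ R_zero])

lemma is_char_\<sigma>_pow: "is_char R \<chi> \<Longrightarrow> is_char R (\<chi> \<circ> (\<sigma> ^^ n))"
  unfolding is_char_def comp_def
  using \<sigma>_pow_closed \<sigma>_pow_add \<sigma>_pow_mult \<sigma>_pow_scale \<sigma>_pow_one by simp

lemma is_char_e: "is_char R e"
  using linf_e e_mult e_one by (simp add: is_char_def linf_def)

lemma subspace_G: "subspace (G n)"
  unfolding subspace_def using G_zero G_add G_scale by blast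

text \<open>The leading coefficient of a product of second factors is
  \<open>co v n * (\<sigma> ^^ n) (co w m)\<close>; this is where the twisted character in the
  second slice comes from.\<close>

lemma U_L_mult:
  assumes "rsupp a (G (Suc n))" "rsupp b (G (Suc m))" "is_char R \<chi>"
  shows "U (L (n + m) \<chi>) (a * b) = U (L n \<chi>) a * U (L m (\<chi> \<circ> (\<sigma> ^^ n))) b"
proof (rule U_mult [OF assms(1,2)])
  fix v w assume vw: "v \<in> G (Suc n)" "w \<in> G (Suc m)"
  have c: "co v n \<in> R" "(\<sigma> ^^ n) (co w m) \<in> R"
    using vw by (auto intro!: co_closed \<sigma>_pow_closed G_subset_B)
  have "L (n + m) \<chi> (v * w) = \<chi> (co v n * (\<sigma> ^^ n) (co w m))"
    using co_mult_leading [OF vw] by (simp add: L_G)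
  also have "\<dots> = \<chi> (co v n) * \<chi> ((\<sigma> ^^ n) (co w m))"
    using assms(3) c by (simp add: is_char_def)
  finally show "L (n + m) \<chi> (v * w) = L n \<chi> v * L m (\<chi> \<circ> (\<sigma> ^^ n)) w"
    using vw by (simp add: L_G)
qed (use assms(3) in \<open>auto intro: linf_L is_char_\<sigma>_pow\<close>)

lemma rsupp_R_G: "a \<in> R \<Longrightarrow> rsupp a (G (Suc 0))"
  unfolding G_1 by (rule rsupp_R)

text \<open>One finite expansion of \<open>\<Delta> y\<close> serves every functional, so all slices
  are combinations of finitely many.\<close>

lemma rsupp_y_bounded: "\<exists>n. rsupp y (G (Suc n))"
proof -
  obtain bs \<beta> where bs: "finite bs" "\<And>b. linf (\<beta> b)"
    "\<And>G. bilin G \<Longrightarrow> Dsum G y = (\<Sum>b\<in>bs. G b (T (\<beta> b) y))"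
    by (rule Dsum_expand [of y]) blast
  have "\<exists>n. T (\<beta> b) y \<in> G n" for b
    using rsupp_y_B bs(2) by (auto simp: rsupp_def B_def)
  then obtain N where N: "\<And>b. T (\<beta> b) y \<in> G (N b)" by metis
  define M where "M = (\<Sum>b\<in>bs. N b)"
  have M: "T (\<beta> b) y \<in> G (Suc M)" if "b \<in> bs" for b
    using member_le_sum [of b bs N] that bs(1) G_mono [OF _ N [of b], of "Suc M"] by (simp add: M_def)
  have "T f y \<in> G (Suc M)" if "linf f" for f
  proof -
    have "T f y = (\<Sum>b\<in>bs. sc (f b) (T (\<beta> b) y))"
      unfolding T_def [of f] by (rule bs(3) [OF bilin_T [OF that]])
    then show ?thesis using M by (auto intro!: subspace_sum subspace_scale subspace_G)
  qed
  then show ?thesis by (auto simp: rsupp_def)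
qed

text \<open>The degree in \<open>y\<close> of the second factor of \<open>\<Delta> y\<close>;
  \<open>Suc\<close> compensates for the strict bound in \<open>G\<close>.\<close>

definition rdeg :: nat where "rdeg = (LEAST n. rsupp y (G (Suc n)))"

lemma rsupp_y: "rsupp y (G (Suc rdeg))"
  unfolding rdeg_def using rsupp_y_bounded by (rule LeastI_ex [of "\<lambda>n. rsupp y (G (Suc n))"])

lemma co_y: "co y (Suc 0) = 1"
  using co_monom [OF R_one, of 1 1] by simp

text \<open>The counit slice of \<open>\<Delta> y\<close> is \<open>y\<close> itself, which has
  degree one.\<close>

lemma rdeg_pos: "rdeg > 0"
proof (rule ccontr)
  assume "\<not> ?thesis"
  then have "T e y \<in> G (Suc 0)" using rsupp_y linf_e by (simp add: rsupp_def)
  then have "co y (Suc 0) = 0" by (simp add: T_e co_zero_G)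
  then show False by (simp add: co_y)
qed

lemma leading_slice: "\<exists>f. linf f \<and> co (T f y) rdeg \<noteq> 0"
proof (rule ccontr)
  assume *: "\<not> ?thesis"
  obtain k where k: "rdeg = Suc k" using rdeg_pos by (cases rdeg) auto
  have "T f y \<in> G rdeg" if "linf f" for f
    using * that rsupp_y by (auto simp: rsupp_def intro: G_reduce [of _ rdeg])
  then have "rsupp y (G (Suc k))" by (simp add: rsupp_def k)
  then have "rdeg \<le> k" unfolding rdeg_def by (rule Least_le)
  with k show False by simp
qed

lemma rsupp_y_pow: "rsupp (y ^ j) (G (Suc (rdeg * j)))"
proof (induction j)
  case 0
  show ?case using rsupp_R_G [OF R_one] by simp
next
  case (Suc j)
  have "v * w \<in> G (Suc (rdeg + rdeg * j))"
    if "v \<in> G (Suc rdeg)" "w \<in> G (Suc (rdeg * j))" for v w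
    using co_mult_leading(1) [OF that] .
  from rsupp_mult [OF rsupp_y Suc subspace_G this] show ?case by simp
qed

lemma rsupp_monom:
  assumes "r \<in> R"
  shows "rsupp (r * y ^ j) (G (Suc (rdeg * j)))"
proof (rule rsupp_mult [OF rsupp_R_G [OF assms] rsupp_y_pow subspace_G])
  fix v w assume "v \<in> G (Suc 0)" "w \<in> G (Suc (rdeg * j))"
  from co_mult_leading(1) [OF this] show "v * w \<in> G (Suc (rdeg * j))" by simp
qed

lemma rsupp_G: "z \<in> G (Suc m) \<Longrightarrow> rsupp z (G (Suc (rdeg * m)))"
proof (induction m arbitrary: z)
  case 0
  then show ?case using rsupp_R_G by (simp add: G_1)
next
  case (Suc m)
  then obtain r g where rg: "r \<in> R" "g \<in> G (Suc m)" "z = r * y ^ Suc m + g"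
    by (metis G_Suc)
  have "G (Suc (rdeg * m)) \<subseteq> G (Suc (rdeg * Suc m))" by (auto intro: G_mono [rotated])
  with Suc.IH [OF rg(2)] have "rsupp g (G (Suc (rdeg * Suc m)))" by (rule rsupp_mono)
  then show ?case unfolding rg(3) by (rule rsupp_add [OF rsupp_monom [OF rg(1)] _ subspace_G])
qed

text \<open>\<open>U_L_mult\<close> splits the slice into a product of slices of \<open>y\<close> at
  the characters \<open>\<chi> \<circ> (\<sigma> ^^ (rdeg * i))\<close>. The functional
  \<open>f\<close> detects that each of them is nonzero, and the algebra is a domain.\<close>

lemma U_y_pow_nonzero:
  assumes f: "linf f"
  shows "is_char R \<chi> \<Longrightarrow> (\<And>i. i < j \<Longrightarrow> \<chi> ((\<sigma> ^^ (rdeg * i)) (co (T f y) rdeg)) \<noteq> 0) \<Longrightarrow>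
    U (L (rdeg * j) \<chi>) (y ^ j) \<noteq> 0"
proof (induction j arbitrary: \<chi>)
  case 0
  have "U (L 0 \<chi>) 1 = sc (L 0 \<chi> 1) 1"
    unfolding U_def using 0 by (intro Dsum_one bilin_U linf_L)
  moreover have "L 0 \<chi> 1 = 1" using 0 R_one by (simp add: L_G [of _ "Suc 0"] G_1 co_0 is_char_def)
  ultimately show ?case by simp
next
  case (Suc j)
  let ?\<chi> = "\<chi> \<circ> (\<sigma> ^^ rdeg)"
  have "?\<chi> ((\<sigma> ^^ (rdeg * i)) (co (T f y) rdeg)) \<noteq> 0" if "i < j" for i
    using Suc.prems(2) [of "Suc i"] that by (simp add: funpow_add)
  from Suc.IH [OF is_char_\<sigma>_pow [OF Suc.prems(1)] this]
  have 1: "U (L (rdeg * j) ?\<chi>) (y ^ j) \<noteq> 0" .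
  have Tf: "T f y \<in> G (Suc rdeg)" using rsupp_y f by (simp add: rsupp_def)
  have "f (U (L rdeg \<chi>) y) = \<chi> (co (T f y) rdeg)"
    using functional_U [OF f linf_L [OF Suc.prems(1)]] L_G [OF Tf] by simp
  also have "\<dots> \<noteq> 0" using Suc.prems(2) [of 0] by simp
  finally have "U (L rdeg \<chi>) y \<noteq> 0" using linf_zero [OF f] by auto
  moreover have "U (L (rdeg * Suc j) \<chi>) (y ^ Suc j) = U (L rdeg \<chi>) y * U (L (rdeg * j) ?\<chi>) (y ^ j)"
    using U_L_mult [OF rsupp_y rsupp_y_pow Suc.prems(1), of j] by simp
  ultimately show ?case using 1 domain by auto
qed

lemma char_prod_list:
  assumes "is_char R \<chi>" "set xs \<subseteq> R"
  shows "prod_list xs \<in> R" "\<chi> (prod_list xs) = prod_list (map \<chi> xs)"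
proof -
  have "prod_list xs \<in> R \<and> \<chi> (prod_list xs) = prod_list (map \<chi> xs)"
    using assms(2)
  proof (induction xs)
    case Nil
    then show ?case using assms(1) R_one by (simp add: is_char_def)
  next
    case (Cons x xs)
    then show ?case using assms(1) R_mult by (simp add: is_char_def)
  qed
  then show "prod_list xs \<in> R" "\<chi> (prod_list xs) = prod_list (map \<chi> xs)" by auto
qed

text \<open>If \<open>y\<close> has right degree \<open>n\<close>, comparing degrees in the third factor of
  \<open>(\<Delta> \<otimes> 1) \<Delta> y = (1 \<otimes> \<Delta>) \<Delta> y\<close> gives \<open>n\<^sup>2 \<le> n\<close>; the leading term on the right is seen to be
  nonzero by evaluating its last factor at a generic point of \<open>R\<close>.\<close>

lemma rdeg_eq_1: "rdeg = 1"
proof (rule ccontr)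
  assume ne: "rdeg \<noteq> 1"
  let ?n = rdeg
  have gt: "Suc ?n \<le> ?n * ?n" using ne rdeg_pos by (cases ?n) auto
  obtain f where f: "linf f" and r: "co (T f y) ?n \<noteq> 0" using leading_slice by blast
  let ?r = "co (T f y) ?n"
  have Tf: "T f y \<in> G (Suc ?n)" using rsupp_y f by (simp add: rsupp_def)
  have rR: "?r \<in> R" using Tf by (intro co_closed G_subset_B)
  \<comment> \<open>One character has to be nonzero on all these twists of the leading coefficient;
    it is found by separating their product from zero.\<close>
  let ?xs = "map (\<lambda>i. (\<sigma> ^^ (?n * i)) ?r) [0..<?n]"
  have xsR: "set ?xs \<subseteq> R" using rR \<sigma>_pow_closed by auto
  have "prod_list xs \<noteq> 0" if "0 \<notin> set xs" for xs :: "'h list"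
    using that domain by (induction xs) auto
  then have "prod_list ?xs \<noteq> 0" using \<sigma>_pow_nonzero [OF rR r] by (metis (no_types, lifting) ex_map_conv)
  moreover have "prod_list ?xs \<in> R" using char_prod_list [OF is_char_e xsR] by blast
  ultimately obtain \<chi> where \<chi>: "is_char R \<chi>" "\<chi> (prod_list ?xs) \<noteq> 0"
    using separate by (auto simp: chars_separate_def)
  have nz: "\<chi> ((\<sigma> ^^ (?n * i)) ?r) \<noteq> 0" if "i < ?n" for i
  proof -
    have "prod_list (map \<chi> ?xs) \<noteq> 0" using char_prod_list(2) [OF \<chi>(1) xsR] \<chi>(2) by simp
    then have "0 \<notin> set (map \<chi> ?xs)" by (simp only: prod_list_zero_iff not_False_eq_True)
    then show ?thesis using that by force
  qed
  let ?L = "L (?n * ?n) \<chi>"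
  have linL: "linf ?L" using \<chi>(1) by (rule linf_L)
  obtain g where g: "g \<in> G ?n" "T f y = ?r * y ^ ?n + g" using G_leading [OF Tf] by blast
  \<comment> \<open>\<open>U ?L\<close> reads the coefficient of \<open>y ^ (?n * ?n)\<close> in the
    last factor. It vanishes on \<open>y\<close>, whose right degree is only \<open>?n\<close>, and
    by \<open>U_T_commute\<close> also on the slice \<open>T f y\<close>.\<close>
  have "U ?L y = 0" using L_G_zero [OF \<chi>(1) _ gt] by (intro U_zero [OF rsupp_y linL])
  then have "U ?L (T f y) = 0" using U_T_commute [OF f linL] lin_zero [OF lin_T [OF f]] by simp
  \<comment> \<open>The lower terms of the slice have right degree at most
    \<open>?n * (?n - 1)\<close>, so only its leading term can contribute.\<close>
  moreover have "U ?L g = 0"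
  proof -
    obtain k where k: "?n = Suc k" using rdeg_pos by (cases ?n) auto
    have "Suc (?n * k) \<le> ?n * ?n" using k by simp
    then show ?thesis using rsupp_G [of g k] g(1) k L_G_zero [OF \<chi>(1)] linL
      by (metis U_zero)
  qed
  moreover have "U ?L (?r * y ^ ?n) = U (L 0 \<chi>) ?r * U ?L (y ^ ?n)"
    using U_L_mult [OF rsupp_R_G [OF rR] rsupp_y_pow \<chi>(1), of ?n] by simp
  ultimately have "U (L 0 \<chi>) ?r * U ?L (y ^ ?n) = 0"
    using lin_U [OF linL] g(2) unfolding lin_def by (metis add.right_neutral)
  moreover have "U ?L (y ^ ?n) \<noteq> 0" using nz by (intro U_y_pow_nonzero [OF f \<chi>(1)])
  moreover have "U (L 0 \<chi>) ?r \<noteq> 0"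
  proof -
    have "e (U (L 0 \<chi>) ?r) = \<chi> ?r"
      using functional_U [OF linf_e linf_L [OF \<chi>(1)]] rR
      by (simp add: T_e L_G [of _ "Suc 0"] G_1 co_0)
    also have "\<dots> \<noteq> 0" using nz [OF rdeg_pos] by simp
    finally show ?thesis using linf_zero [OF linf_e] by auto
  qed
  ultimately show False using domain by blast
qed

section \<open>The coefficient of \<open>y\<close> in \<open>\<Delta> y\<close> and the resulting
  form of \<open>\<sigma>\<close>\<close>

lemma rsupp_y_2: "rsupp y (G (Suc (Suc 0)))"
  using rsupp_y by (simp add: rdeg_eq_1)

lemma U_L0_e: "a \<in> R \<Longrightarrow> U (L 0 e) a = a"
proof -
  assume a: "a \<in> R"
  have "U (L 0 e) a = U e a"
    by (rule U_cong [OF rsupp_R [OF a] linf_L [OF is_char_e] linf_e])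
      (simp add: L_G [of _ "Suc 0"] G_1 co_0)
  then show ?thesis by (simp add: U_e)
qed

lemma U_L1_R: "is_char R \<chi> \<Longrightarrow> a \<in> R \<Longrightarrow> U (L (Suc 0) \<chi>) a = 0"
  using L_G_zero by (intro U_zero [OF rsupp_R_G linf_L]) auto

lemma U_L1_left: "a \<in> R \<Longrightarrow> U (L (Suc 0) e) (a * y) = a * U (L (Suc 0) e) y"
  using U_L_mult [OF rsupp_R_G rsupp_y_2 is_char_e, of a] by (simp add: U_L0_e)

text \<open>The coefficient \<open>g\<close> of \<open>y\<close> in the right factor of \<open>\<Delta> y\<close>, evaluated at the counit, satisfies
  \<open>\<Delta> g = A (1 \<otimes> g)\<close> with \<open>A\<close> the full coefficient; the antipode turns this into a left inverse.\<close>

lemma U_L1_y: "U (L (Suc 0) e) y = 1"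
proof -
  let ?L = "L (Suc 0) e"
  let ?g = "U ?L y"
  have linL: "linf ?L" using is_char_e by (rule linf_L)
  have slice: "T f ?g = cf (Suc 0) (T f y) * ?g" if f: "linf f" for f
  proof -
    have Tf: "T f y \<in> G (Suc (Suc 0))" using rsupp_y_2 f by (simp add: rsupp_def)
    let ?r = "co (T f y) (Suc 0)"
    have r: "?r \<in> R" using Tf by (intro co_closed G_subset_B)
    obtain s where s: "s \<in> R" "T f y = ?r * y + s" using G_leading [OF Tf] by (auto simp: G_1)
    have "T f ?g = U ?L (T f y)" using U_T_commute [OF f linL] by simp
    also have "\<dots> = U ?L (?r * y) + U ?L s"
      using s(2) lin_U [OF linL] unfolding lin_def by metis
    also have "\<dots> = ?r * ?g" using r s(1) by (simp add: U_L1_left U_L1_R is_char_e)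
    finally show ?thesis using Tf by (simp add: cf_B G_subset_B)
  qed
  have "e ?g = 1"
    using functional_U [OF linf_e linL, of y] y_in_G by (simp add: T_e L_G co_y e_one)
  have "sc (e ?g) 1 = Dsum (\<lambda>x z. S x * z) ?g" by (simp add: antipode)
  also have "\<dots> = Dsum (\<lambda>x z. S x * (cf (Suc 0) z * ?g)) y"
  proof (rule Dsum_transfer)
    show "bilin (\<lambda>x z. S x * z)"
      using lin_S by (auto simp: bilin_def lin_def algebra_simps sc_mult_left sc_mult_right)
    show "lin (\<lambda>z. cf (Suc 0) z * ?g)"
      using lin_cf [of "Suc 0"] by (auto simp: lin_def algebra_simps sc_mult_left)
  qed (rule slice)
  also have "\<dots> = Dsum (\<lambda>x z. S x * cf (Suc 0) z) y * ?g"
    by (subst Dsum_lin_out) (auto simp: lin_def algebra_simps sc_mult_left)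
  finally obtain u where u: "u * ?g = 1" using \<open>e ?g = 1\<close> by simp
  \<comment> \<open>In a domain the left inverse is two-sided, so \<open>?g\<close> is a unit, hence
    a scalar, which the counit identifies as \<open>1\<close>.\<close>
  have "(?g * u - 1) * ?g = 0" using u by (simp add: left_diff_distrib mult.assoc)
  then have "?g * u = 1" using domain u by fastforce
  then obtain c where c: "?g = sc c 1" using units by blast
  then have "c = 1" using \<open>e ?g = 1\<close> linf_e e_one by (simp add: linf_def)
  with c show ?thesis by simp
qed

text \<open>Apply \<open>U (L (Suc 0) e)\<close> to
  \<open>y * a = \<sigma> a * y + \<delta> a\<close>: since the slice of \<open>y\<close> is
  \<open>1\<close>, only \<open>\<sigma> a\<close> is left on the right. Thus
  \<open>\<sigma>\<close> is the winding automorphism of the character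
  \<open>e \<circ> \<sigma>\<close>.\<close>

lemma \<sigma>_winding: "a \<in> R \<Longrightarrow> \<sigma> a = U (L 0 (e \<circ> \<sigma>)) a"
proof -
  assume a: "a \<in> R"
  let ?L = "L (Suc 0) e"
  have linL: "linf ?L" using is_char_e by (rule linf_L)
  have "U ?L (y * a) = U (L 0 (e \<circ> \<sigma>)) a"
    using U_L_mult [OF rsupp_y_2 rsupp_R_G [OF a] is_char_e] by (simp add: U_L1_y)
  moreover have "U ?L (y * a) = U ?L (\<sigma> a * y) + U ?L (\<delta> a)"
    using comm [OF a] lin_U [OF linL] by (simp add: lin_def)
  moreover have "U ?L (\<sigma> a * y) = \<sigma> a" using a by (simp add: U_L1_left \<sigma>_closed U_L1_y)
  moreover have "U ?L (\<delta> a) = 0" using a by (simp add: U_L1_R is_char_e \<delta>_closed)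
  ultimately show ?thesis by simp
qed

end

context hopf_alg
begin

text \<open>\<open>\<Delta> x = a (1 \<otimes> x) + b\<close> with \<open>a, b \<in> H \<otimes> A\<close> and \<open>(1 \<otimes> \<epsilon>) a = 1\<close>.\<close>

definition quasi_primitive :: "'h set \<Rightarrow> 'h \<Rightarrow> bool" where
  "quasi_primitive A x \<longleftrightarrow> rsupp x {r * x + s |r s. r \<in> A \<and> s \<in> A} \<and>
     (\<forall>f. linf f \<and> (\<forall>r\<in>A. \<forall>s\<in>A. f (r * x + s) = e r) \<longrightarrow> U f x = 1)"

end

context hopf_ore
begin

lemma quasi_primitive_y: "quasi_primitive R y"
proof -
  have eq: "G (Suc (Suc 0)) = {r * y + s |r s. r \<in> R \<and> s \<in> R}"
    using G_Suc [of _ "Suc 0"] by (simp add: G_1 set_eq_iff) blast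
  have "U f y = 1" if "linf f" "\<forall>r\<in>R. \<forall>s\<in>R. f (r * y + s) = e r" for f
  proof -
    have "U f y = U (L (Suc 0) e) y"
    proof (rule U_cong [OF rsupp_y_2 that(1) linf_L [OF is_char_e]])
      fix w assume w: "w \<in> G (Suc (Suc 0))"
      then obtain r s where rs: "r \<in> R" "s \<in> R" "w = r * y + s" using eq by auto
      then have "co w (Suc 0) = r" using co_leading [of r s "Suc 0"] by (simp add: G_1)
      then show "f w = L (Suc 0) e w" using that(2) rs w by (simp add: L_G)
    qed
    then show ?thesis by (simp add: U_L1_y)
  qed
  then show ?thesis using rsupp_y_2 by (simp add: quasi_primitive_def eq)
qed

text \<open>On the tower of subalgebras below \<open>R\<close>, \<open>\<sigma>\<close> translates each new generator by a scalar, so a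
  nontrivial \<open>\<sigma>\<close> has infinite order in characteristic zero.\<close>

lemma \<sigma>_fixes_quasi_primitive:
  assumes char: "\<And>n. n > 0 \<Longrightarrow> of_nat n \<noteq> (0 :: 'k)"
    and m: "m > 0" "\<And>a. a \<in> R \<Longrightarrow> (\<sigma> ^^ m) a = a"
    and A: "A \<subseteq> R" "\<And>a. a \<in> A \<Longrightarrow> \<sigma> a = a"
    and x: "x \<in> R" "quasi_primitive A x"
  shows "\<sigma> x = x"
proof -
  let ?\<chi> = "L 0 (e \<circ> \<sigma>)"
  \<comment> \<open>The scalar by which \<open>\<sigma>\<close> will turn out to translate
    \<open>x\<close>.\<close>
  define \<kappa> where "\<kappa> = e (\<sigma> x) - e x"
  have "is_char R (e \<circ> \<sigma>)" using is_char_\<sigma>_pow [OF is_char_e, of 1] by simp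
  then have lin\<chi>: "linf ?\<chi>" by (rule linf_L)
  have e_lin: "e (a + b) = e a + e b" for a b using linf_e by (simp add: linf_def)
  have val: "?\<chi> (r * x + s) = e (r * x + s) + \<kappa> * e r" if "r \<in> A" "s \<in> A" for r s
  proof -
    have R: "r \<in> R" "s \<in> R" "r * x \<in> R" "r * x + s \<in> R" using that A(1) x(1) by (auto intro: R_closed)
    then have "?\<chi> (r * x + s) = e (\<sigma> (r * x + s))" by (simp add: L_G [of _ "Suc 0"] G_1 co_0)
    also have "\<sigma> (r * x + s) = r * \<sigma> x + s" using R x(1) A(2) that by (simp add: \<sigma>_add \<sigma>_mult)
    finally show ?thesis by (simp add: \<kappa>_def e_lin e_mult algebra_simps comp_def)
  qed
  have supp: "rsupp x {r * x + s |r s. r \<in> A \<and> s \<in> A}"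
    using x(2) by (simp add: quasi_primitive_def)
  show ?thesis
  proof (cases "\<kappa> = 0")
    case True
    have "\<sigma> x = U e x"
      unfolding \<sigma>_winding [OF x(1)]
      by (rule U_cong [OF supp lin\<chi> linf_e]) (use val True in auto)
    then show ?thesis by (simp add: U_e)
  next
    case False
    \<comment> \<open>By \<open>val\<close> this functional sends \<open>r * x + s\<close> to
      \<open>e r\<close>, which is what quasi-primitivity asks for in order to give the slice
      \<open>1\<close>.\<close>
    let ?f = "\<lambda>w. (?\<chi> w - e w) / \<kappa>"
    have linf: "linf ?f" using lin\<chi> linf_e by (auto simp: linf_def field_simps add_divide_distrib diff_divide_distrib)
    moreover have "\<forall>r\<in>A. \<forall>s\<in>A. ?f (r * x + s) = e r" using val False by simp
    ultimately have one: "U ?f x = 1" using x(2) by (simp add: quasi_primitive_def)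
    have "U ?\<chi> x = U e x + sc \<kappa> (U ?f x)"
    proof -
      have "lin (sc \<kappa>)" by (simp add: lin_def scale_right_distrib mult.commute)
      then have "sc \<kappa> (U ?f x) = Dsum (\<lambda>u v. sc (?\<chi> v) u - sc (e v) u) x"
        unfolding U_def using False by (simp add: Dsum_lin_out scale_left_diff_distrib)
      then show ?thesis by (simp add: Dsum_minus U_def)
    qed
    then have \<sigma>x: "\<sigma> x = x + sc \<kappa> 1" using one by (simp add: \<sigma>_winding [OF x(1)] U_e)
    \<comment> \<open>At \<open>j = m\<close> the total translation
      \<open>of_nat m * \<kappa>\<close> has to vanish, although \<open>\<kappa>\<close> is
      nonzero.\<close>
    have "(\<sigma> ^^ j) x = x + sc (of_nat j * \<kappa>) 1" for j
    proof (induction j)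
      case 0
      then show ?case by simp
    next
      case (Suc j)
      have "(\<sigma> ^^ Suc j) x = \<sigma> x + sc (of_nat j * \<kappa>) 1"
        using Suc x(1) by (simp add: \<sigma>_add \<sigma>_scale R_one R_scalar \<sigma>_one)
      then show ?case by (simp add: \<sigma>x distrib_right scale_left_distrib add.assoc)
    qed
    from this [of m] m x(1) have "sc (of_nat m * \<kappa>) 1 = 0" by simp
    then show ?thesis using char [OF m(1)] False by simp
  qed
qed

end

section \<open>Iterated Hopf Ore extensions\<close>

locale poly_ext = ore_ext +
  assumes commR: "a \<in> R \<Longrightarrow> b \<in> R \<Longrightarrow> a * b = b * a"
    and \<sigma>_id: "a \<in> R \<Longrightarrow> \<sigma> a = a" and \<delta>_zero: "a \<in> R \<Longrightarrow> \<delta> a = 0"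
begin

lemma monom_mult:
  assumes "s \<in> R"
  shows "(r * y ^ n) * (s * y ^ m) = (r * s) * y ^ (n + m)"
proof -
  have "y * s = s * y" using comm [OF assms] assms by (simp add: \<sigma>_id \<delta>_zero)
  then have "y ^ n * s = s * y ^ n" by (rule power_commuting_commutes)
  then show ?thesis by (metis mult.assoc power_add)
qed

lemma B_comm: "z \<in> B \<Longrightarrow> w \<in> B \<Longrightarrow> z * w = w * z"
proof -
  have mono: "(r * y ^ n) * w = w * (r * y ^ n)" if "r \<in> R" "w \<in> G m" for r n w m
    using that(2)
  proof (induction m arbitrary: w)
    case 0
    then show ?case by (simp add: G_0)
  next
    case (Suc m)
    then obtain s h where "s \<in> R" "h \<in> G m" "w = s * y ^ m + h" by (metis G_Suc)
    with Suc.IH that(1) show ?case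
      by (simp add: distrib_left distrib_right monom_mult commR [of r s] add.commute)
  qed
  have "z * w = w * z" if "z \<in> G n" "w \<in> G m" for z w n m
    using that(1)
  proof (induction n arbitrary: z)
    case 0
    then show ?case by (simp add: G_0)
  next
    case (Suc n)
    then obtain r g where "r \<in> R" "g \<in> G n" "z = r * y ^ n + g" by (metis G_Suc)
    with Suc.IH mono [OF _ that(2)] show ?case by (simp add: distrib_left distrib_right)
  qed
  then show "z \<in> B \<Longrightarrow> w \<in> B \<Longrightarrow> z * w = w * z" by (auto simp: B_def)
qed

text \<open>The extension is evaluation at \<open>y = t\<close>; it is multiplicative because
  \<open>y\<close> commutes with \<open>R\<close>.\<close>

lemma is_char_extend:
  assumes \<chi>: "is_char R \<chi>"
  obtains \<chi>' where "is_char B \<chi>'" "\<And>w n. w \<in> G n \<Longrightarrow> \<chi>' w = (\<Sum>m<n. \<chi> (co w m) * t ^ m)"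
proof -
  \<comment> \<open>The least bound only makes \<open>\<chi>'\<close> a function of
    \<open>w\<close>; \<open>eval\<close> shows that every bound gives the same sum.\<close>
  define \<chi>' where "\<chi>' w = (\<Sum>m<(LEAST n. w \<in> G n). \<chi> (co w m) * t ^ m)" for w
  have \<chi>0: "\<chi> 0 = 0" using is_char_zero [OF \<chi> R_zero] .
  have eval: "\<chi>' w = (\<Sum>m<n. \<chi> (co w m) * t ^ m)" if "w \<in> G n" for w n
  proof -
    let ?k = "LEAST n. w \<in> G n"
    have "w \<in> G ?k" "?k \<le> n" using that by (rule LeastI, rule Least_le)
    then show ?thesis
      unfolding \<chi>'_def by (intro sum.mono_neutral_left) (auto simp: co_zero_G \<chi>0)
  qed
  have add: "\<chi>' (z + w) = \<chi>' z + \<chi>' w" if zw: "z \<in> B" "w \<in> B" for z w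
  proof -
    obtain k l where "z \<in> G k" "w \<in> G l" using zw by (auto simp: B_def)
    then obtain n where n: "z \<in> G n" "w \<in> G n"
      using G_mono [of k "k + l" z] G_mono [of l "k + l" w] by auto
    have "\<chi> (co (z + w) m) = \<chi> (co z m) + \<chi> (co w m)" for m
      using zw \<chi> co_closed by (simp add: co_add is_char_def)
    then show ?thesis using eval [OF n(1)] eval [OF n(2)] eval [OF G_add [OF n]]
      by (simp add: sum.distrib distrib_right)
  qed
  have monom: "\<chi>' (r * y ^ n) = \<chi> r * t ^ n" if "r \<in> R" for r n
    using eval [OF monom_in_G [OF that, of n]] that by (simp add: co_monom \<chi>0)
  have scale: "\<chi>' (sc c w) = c * \<chi>' w" if w: "w \<in> B" for c w
  proof -
    obtain n where n: "w \<in> G n" using w by (auto simp: B_def)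
    have "\<chi> (co (sc c w) m) = c * \<chi> (co w m)" for m
      using w \<chi> co_closed by (simp add: co_scale is_char_def)
    then show ?thesis using eval [OF n] eval [OF G_scale [OF n]]
      by (simp add: sum_distrib_left mult.assoc)
  qed
  have \<chi>_mult: "\<chi> (a * b) = \<chi> a * \<chi> b" if "a \<in> R" "b \<in> R" for a b
    using \<chi> that by (simp add: is_char_def)
  have \<chi>'0: "\<chi>' 0 = 0" using eval [OF G_zero [of 0]] by simp
  have mB: "r * y ^ n \<in> B" if "r \<in> R" for r n using monom_in_G [OF that] by (rule G_subset_B)
  have B_mult: "z * w \<in> B" if "z \<in> B" "w \<in> B" for z w
    using B_subalgebra that by (simp add: subalgebra_def)
  have mono: "\<chi>' (r * y ^ n * w) = \<chi>' (r * y ^ n) * \<chi>' w" if r: "r \<in> R" and "w \<in> G m" for r n w m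
    using that(2)
  proof (induction m arbitrary: w)
    case 0
    then show ?case by (simp add: G_0 \<chi>'0)
  next
    case (Suc m)
    then obtain s h where sh: "s \<in> R" "h \<in> G m" "w = s * y ^ m + h" by (metis G_Suc)
    have "\<chi>' (r * y ^ n * w) = \<chi>' ((r * s) * y ^ (n + m) + r * y ^ n * h)"
      using sh monom_mult [OF sh(1)] by (simp add: distrib_left)
    also have "\<dots> = \<chi>' ((r * s) * y ^ (n + m)) + \<chi>' (r * y ^ n * h)"
      using r sh by (intro add mB R_mult B_mult G_subset_B [OF sh(2)])
    also have "\<dots> = \<chi>' (r * y ^ n) * (\<chi>' (s * y ^ m) + \<chi>' h)"
      unfolding monom [OF R_mult [OF r sh(1)]] Suc.IH [OF sh(2)] monom [OF r] monom [OF sh(1)]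
      using r sh by (simp add: \<chi>_mult power_add algebra_simps)
    also have "\<chi>' (s * y ^ m) + \<chi>' h = \<chi>' w"
      unfolding sh(3) using sh by (intro add [symmetric] mB G_subset_B [OF sh(2)])
    finally show ?case .
  qed
  have mult: "\<chi>' (z * w) = \<chi>' z * \<chi>' w" if z: "z \<in> G n" and w: "w \<in> B" for z w n
    using z
  proof (induction n arbitrary: z)
    case 0
    then show ?case by (simp add: G_0 \<chi>'0)
  next
    case (Suc n)
    then obtain r g where rg: "r \<in> R" "g \<in> G n" "z = r * y ^ n + g" by (metis G_Suc)
    obtain m where m: "w \<in> G m" using w by (auto simp: B_def)
    have "\<chi>' (z * w) = \<chi>' (r * y ^ n * w + g * w)"
      using rg by (simp add: distrib_right)
    also have "\<dots> = \<chi>' (r * y ^ n * w) + \<chi>' (g * w)"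
      using rg w by (intro add mB B_mult G_subset_B [OF rg(2)])
    also have "\<dots> = (\<chi>' (r * y ^ n) + \<chi>' g) * \<chi>' w"
      using rg mono [OF rg(1) m] Suc.IH by (simp add: distrib_right)
    also have "\<chi>' (r * y ^ n) + \<chi>' g = \<chi>' z"
      unfolding rg(3) using rg by (intro add [symmetric] mB G_subset_B [OF rg(2)])
    finally show ?case .
  qed
  have "\<chi>' 1 = 1" using monom [OF R_one, of 0] \<chi> by (simp add: is_char_def)
  moreover have "\<chi>' (z * w) = \<chi>' z * \<chi>' w" if "z \<in> B" "w \<in> B" for z w
  proof -
    from that(1) obtain n where "z \<in> G n" by (auto simp: B_def)
    then show ?thesis using that(2) by (rule mult)
  qed
  ultimately have "is_char B \<chi>'" using add scale by (simp add: is_char_def)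
  then show ?thesis using eval that by blast
qed

text \<open>A character of \<open>R\<close> first keeps the leading coefficient nonzero; the
  resulting polynomial in \<open>t\<close> is then nonzero and has a non-root in the infinite
  field.\<close>

lemma chars_separate_B:
  assumes "infinite (UNIV :: 'a set)" "chars_separate R"
  shows "chars_separate B"
  unfolding chars_separate_def
proof (intro ballI impI)
  fix z assume z: "z \<in> B" "z \<noteq> 0"
  then obtain n where n: "z \<in> G (Suc n)" "co z n \<noteq> 0" by (rule exact_degree)
  then obtain \<chi> where \<chi>: "is_char R \<chi>" "\<chi> (co z n) \<noteq> 0"
    using assms(2) z co_closed by (auto simp: chars_separate_def)
  define p where "p = (\<Sum>m<Suc n. Polynomial.monom (\<chi> (co z m)) m)"
  have "Polynomial.coeff p n = \<chi> (co z n)" by (simp add: p_def Polynomial.coeff_sum)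
  then have "p \<noteq> 0" using \<chi>(2) by auto
  then have "finite {t. poly p t = 0}" by (rule poly_roots_finite)
  then obtain t where t: "poly p t \<noteq> 0" using assms(1) by (metis (mono_tags) UNIV_eq_I mem_Collect_eq)
  obtain \<chi>' where \<chi>': "is_char B \<chi>'" "\<And>w n. w \<in> G n \<Longrightarrow> \<chi>' w = (\<Sum>m<n. \<chi> (co w m) * t ^ m)"
    using is_char_extend [OF \<chi>(1)] by blast
  have "\<chi>' z = poly p t" unfolding \<chi>'(2) [OF n(1)] p_def poly_sum poly_monom ..
  with t \<chi>'(1) show "\<exists>\<chi>. is_char B \<chi> \<and> \<chi> z \<noteq> 0" by auto
qed

end

section \<open>Induction along the tower of Hopf subalgebras\<close>

locale ihoe = hopf_alg sc D e S
  for sc :: "'k::field_char_0 \<Rightarrow> 'h::ring_1 \<Rightarrow> 'h" and D e S +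
  fixes n :: nat and x :: "nat \<Rightarrow> 'h"
  assumes IHOE: "IHOE sc D e S n x"
begin

definition H :: "nat \<Rightarrow> 'h set" where "H i = subalg sc (x ` {1..i})"

lemma H_0: "H 0 = range (\<lambda>c. sc c 1)"
proof -
  have "\<exists>c. a = sc c 1" if "a \<in> subalg sc {}" for a
    using that
    by induction (auto simp: sc_mult_left scale_left_distrib [symmetric])
  then show ?thesis by (auto simp: H_def intro: subalg.scalar)
qed

lemma H_n: "H n = UNIV"
  using IHOE by (simp add: IHOE_def H_def)

lemma subalgebra_H: "subalgebra (H i)"
  unfolding H_def by (rule subalgebra_subalg)

lemma H_mono: "i \<le> j \<Longrightarrow> H i \<subseteq> H j"
proof
  fix a assume ij: "i \<le> j" and "a \<in> H i"
  then have "a \<in> subalg sc (x ` {1..i})" by (simp add: H_def)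
  then show "a \<in> H j" unfolding H_def
  proof induction
    case (gen a)
    then have "a \<in> x ` {1..j}" using ij by auto
    then show ?case by (rule subalg.gen)
  qed (auto intro: subalg.intros)
qed

lemma H_Suc: "H (Suc i) = subalg sc (insert (x (Suc i)) (x ` {1..i}))"
  by (simp add: H_def atLeastAtMostSuc_conv)

lemma x_in_H: "x (Suc i) \<in> H (Suc i)"
  unfolding H_Suc by (rule subalg.gen) simp

lemma H_ore: "i < n \<Longrightarrow> \<exists>\<sigma> \<delta>. ore_ext sc (H i) (x (Suc i)) \<sigma> \<delta>"
proof -
  assume "i < n"
  then have "\<exists>\<sigma> \<delta>. ore_step sc (subalg sc (x ` {1..<Suc i})) (x (Suc i)) \<sigma> \<delta>"
    using IHOE unfolding IHOE_def by (metis Suc_leI atLeastAtMost_iff le_add1 plus_1_eq_Suc)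
  then obtain \<sigma> \<delta> where "ore_step sc (H i) (x (Suc i)) \<sigma> \<delta>"
    by (auto simp: H_def atLeastLessThanSuc_atLeastAtMost)
  then have "ore_ext sc (H i) (x (Suc i)) \<sigma> \<delta>"
    using subalgebra_H by unfold_locales auto
  then show ?thesis by blast
qed

lemma B_eq_H: "ore_ext sc (H i) (x (Suc i)) \<sigma> \<delta> \<Longrightarrow> ore_ext.B (H i) (x (Suc i)) = H (Suc i)"
  unfolding H_Suc by (rule ore_ext.B_eq_subalg) (auto simp: H_def)

lemma H_domain_units:
  "i \<le> n \<Longrightarrow> (\<forall>a\<in>H i. \<forall>b\<in>H i. (a * b = 0 \<longrightarrow> a = 0 \<or> b = 0) \<and> (a * b = 1 \<longrightarrow> (\<exists>c. a = sc c 1)))"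
proof (induction i)
  case 0
  then show ?case by (auto simp: H_0 sc_mult_left)
next
  case (Suc i)
  from Suc.prems obtain \<sigma> \<delta> where "ore_ext sc (H i) (x (Suc i)) \<sigma> \<delta>"
    using H_ore [of i] by (auto simp: Suc_le_eq)
  then interpret ore_ext sc "H i" "x (Suc i)" \<sigma> \<delta> .
  have B: "H (Suc i) = B" using B_eq_H [OF ore_ext_axioms] ..
  have IH: "a * b = 0 \<Longrightarrow> a = 0 \<or> b = 0" "a * b = 1 \<Longrightarrow> \<exists>c. a = sc c 1"
    if "a \<in> H i" "b \<in> H i" for a b using Suc that by auto
  have "z = 0 \<or> w = 0" if "z \<in> B" "w \<in> B" "z * w = 0" for z w
    by (rule domain_B [OF IH(1) that])
  moreover have "\<exists>c. z = sc c 1" if "z \<in> B" "w \<in> B" "z * w = 1" for z w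
    by (rule units_B [OF IH(1) IH(2) that])
  ultimately show ?case unfolding B by blast
qed

lemma rsupp_H: "i \<le> n \<Longrightarrow> a \<in> H i \<Longrightarrow> rsupp a (H i)"
proof (cases "i = 0")
  \<comment> \<open>The Hopf subalgebra condition in \<open>IHOE\<close> starts at index
    \<open>1\<close>, so the scalars are treated directly.\<close>
  case True
  assume "a \<in> H i"
  then obtain c where "a = sc c 1" using True by (auto simp: H_0)
  moreover have "subspace (H i)" "1 \<in> H i"
    using subalgebra_H [of i] subalgebra_subspace by (auto simp: subalgebra_def) (metis scale_one)
  ultimately show ?thesis by (simp add: rsupp_scalar)
next
  case False
  assume "i \<le> n" "a \<in> H i"
  then obtain ys where ys: "set ys \<subseteq> H i \<times> H i" "teq2 sc (D a) ys"
    using IHOE False unfolding IHOE_def hopf_subalg_def H_def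
    by (metis One_nat_def atLeastAtMost_iff not_less_eq_eq le_0_eq)
  have sub: "subspace (H i)" by (rule subalgebra_subspace [OF subalgebra_H])
  show ?thesis unfolding rsupp_def
  proof (intro allI impI)
    fix f assume f: "linf f"
    have "T f a = sum_list (map (\<lambda>(x, y). sc (f x) y) ys)"
      unfolding T_def Dsum_def by (rule teq2_eval [OF ys(2) bilin_T [OF f]])
    also have "\<dots> \<in> H i" using ys(1)
      by (induction ys) (auto intro!: subspace_add [OF sub] subspace_scale [OF sub] subspace_0 [OF sub])
    finally show "T f a \<in> H i" .
  qed
qed

text \<open>The other two clauses feed the next step of the induction: separating characters are a
  hypothesis of \<open>hopf_ore\<close>, and quasi-primitivity of the earlier generators shows that
  the next \<open>\<sigma>\<close> fixes them.\<close>

lemma H_commutative: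
  assumes PI: "satisfies_PI sc"
  shows "i \<le> n \<Longrightarrow> (\<forall>a\<in>H i. \<forall>b\<in>H i. a * b = b * a) \<and> chars_separate (H i) \<and>
    (\<forall>j<i. quasi_primitive (H j) (x (Suc j)))"
proof (induction i)
  case 0
  have "is_char (H 0) e" using linf_e e_mult e_one by (simp add: is_char_def linf_def)
  moreover have "e (sc c 1) = c" for c using linf_e e_one by (simp add: linf_def)
  ultimately have "chars_separate (H 0)" unfolding chars_separate_def H_0 by force
  then show ?case by (auto simp: H_0 sc_mult_left sc_mult_right mult.commute)
next
  case (Suc i)
  from Suc.prems obtain \<sigma> \<delta> where ext: "ore_ext sc (H i) (x (Suc i)) \<sigma> \<delta>"
    using H_ore [of i] by (auto simp: Suc_le_eq)
  then interpret ore_ext sc "H i" "x (Suc i)" \<sigma> \<delta> .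
  have B: "B = H (Suc i)" using B_eq_H [OF ext] .
  have prim_i: "quasi_primitive (H j) (x (Suc j))" if "j < i" for j using Suc that by simp
  have comm_i: "a * b = b * a" if "a \<in> H i" "b \<in> H i" for a b using Suc that by auto
  interpret hopf_ore sc D e S "H i" "x (Suc i)" \<sigma> \<delta>
  proof
    \<comment> \<open>These are taken at the top level, where \<open>H n\<close> is the whole
      algebra.\<close>
    show "a * b = 0 \<Longrightarrow> a = 0 \<or> b = 0" "a * b = 1 \<Longrightarrow> \<exists>c. a = sc c 1" for a b
      using H_domain_units [of n] by (auto simp: H_n)
    show "chars_separate (H i)" using Suc by simp
    show "rsupp a (H i)" if "a \<in> H i" for a using rsupp_H [of i a] Suc.prems that by simp
    show "rsupp (x (Suc i)) B" unfolding B using rsupp_H [OF Suc.prems x_in_H] .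
  qed (rule comm_i)
  have char: "m > 0 \<Longrightarrow> of_nat m \<noteq> (0 :: 'k)" for m by simp
  obtain m where m: "m > 0" "\<And>a. a \<in> H i \<Longrightarrow> (\<sigma> ^^ m) a = a"
    using PI_imp_finite_order [OF PI comm_i domain] by blast
  have fixed: "\<sigma> a = a" if "j \<le> i" "a \<in> H j" for j a
    using that
  proof (induction j arbitrary: a)
    case 0
    then show ?case by (auto simp: H_0 \<sigma>_scale R_one \<sigma>_one)
  next
    case (Suc j)
    have sub: "H j \<subseteq> H i" "H (Suc j) \<subseteq> H i" using Suc.prems(1) H_mono by auto
    have "\<sigma> (x (Suc j)) = x (Suc j)"
    proof (rule \<sigma>_fixes_quasi_primitive [OF char m sub(1)])
      show "\<sigma> a = a" if "a \<in> H j" for a using Suc that by simp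
      show "x (Suc j) \<in> H i" using sub(2) x_in_H by blast
      show "quasi_primitive (H j) (x (Suc j))" using Suc.prems(1) prim_i by simp
    qed
    then have gen: "\<sigma> a = a" if "a \<in> insert (x (Suc j)) (x ` {1..j})" for a
      using that Suc.IH Suc.prems(1) subalg.gen [of a "x ` {1..j}" sc] by (auto simp: H_def)
    have R: "a \<in> H i" if "a \<in> subalg sc (insert (x (Suc j)) (x ` {1..j}))" for a
      using that sub(2) by (auto simp: H_Suc)
    from Suc.prems(2) show ?case unfolding H_Suc
    proof induction
      case (gen a)
      then show ?case using \<open>\<And>a. a \<in> insert (x (Suc j)) (x ` {1..j}) \<Longrightarrow> \<sigma> a = a\<close> by blast
    qed (use R in \<open>auto simp: \<sigma>_add \<sigma>_mult \<sigma>_scale \<sigma>_one R_one\<close>)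
  qed
  then have id: "\<sigma> a = a" if "a \<in> H i" for a using that by blast
  have \<delta>0: "\<delta> a = 0" if "a \<in> H i" for a
    using PI_imp_zero_derivation [OF PI char comm_i domain id that] by simp
  interpret poly_ext sc "H i" "x (Suc i)" \<sigma> \<delta>
    by unfold_locales (use comm_i id \<delta>0 in auto)
  have "chars_separate (H (Suc i))"
    using chars_separate_B infinite_UNIV_char_0 separate by (simp add: B)
  moreover have "\<forall>a\<in>H (Suc i). \<forall>b\<in>H (Suc i). a * b = b * a" using B_comm by (simp add: B)
  moreover have "\<forall>j<Suc i. quasi_primitive (H j) (x (Suc j))"
    using Suc quasi_primitive_y by (auto simp: less_Suc_eq)
  ultimately show ?case by blast
qed

end

theorem theorem5p4:
  fixes sc :: "'k::field_char_0 \<Rightarrow> 'h::ring_1 \<Rightarrow> 'h"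
    and D :: "'h \<Rightarrow> ('h \<times> 'h) list" and e :: "'h \<Rightarrow> 'k" and S :: "'h \<Rightarrow> 'h"
    and n :: nat and x :: "nat \<Rightarrow> 'h"
  assumes "alg_closed_field TYPE('k)"
    and "IHOE sc D e S n x"
    and "satisfies_PI sc"
  shows "\<forall>a b :: 'h. a * b = b * a"
proof -
  interpret ihoe sc D e S n x
    using assms(2) by unfold_locales (auto simp: IHOE_def)
  show ?thesis using H_commutative [OF assms(3), of n] by (simp add: H_n)
qed

end
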